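(* Let $r=\sqrt2-1$. There is a one-to-one correspondence between compact packings of the plane using discs of radius $1$ and $r$ and tilings of the plane using squares with sides of length $2$ and equilateral triangles with sides of length $2$, where at least one square is used. Given a packing, the corresponding tiling is obtained by drawing the line segments between the centres of any two discs of radius $1$ that are tangent. Conversely, given such a tiling, the corresponding compact packing is obtained by putting a disc of radius $1$ at each vertex of the squares and triangles and then putting a disc of radius $r$ at the centre of each square.
   Context: A packing of the plane is a collection of closed discs in $\mathbb{R}^2$ with pairwise disjoint interiors. A packing is compact if for every disc $D$ of the packing, the discs of the packing tangent to $D$, listed in cyclic order around $D$ as $D_1,\dots,D_n$ (with $D_{n+1}=D_1$), are such that $D_i$ is tangent to $D_{i+1}$ for $i=1,\dots,n$, and this chain surrounds $D$: the angles, in $(0,\pi)$, at the centre of $D$ in the triangles with vertices the centres of $D,D_i,D_{i+1}$ sum to $2\pi$. A compact packing using discs of radius $1$ and $r$ is a compact packing in which every disc has radius $1$ or $r$ and discs of both radii occur.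
   Formalization: Tilings are taken to be edge-to-edge (two tiles meet, if at all, in a common vertex or a common edge); otherwise, e.g. for shifted rows of squares, the discs of radius 1 put at the vertices would overlap. *)

theory Defs
  imports "HOL-Analysis.Analysis"
begin

text \<open>
  The plane is the type \<^typ>\<open>complex\<close>.  A closed disc is given by its centre and its
  radius; for positive radii this data is determined by the point set.
\<close>

type_synonym disc = "complex \<times> real"

abbreviation centre :: "disc \<Rightarrow> complex" where "centre \<equiv> fst"
abbreviation radius :: "disc \<Rightarrow> real" where "radius \<equiv> snd"

definition disc_points :: "disc \<Rightarrow> complex set" where
  "disc_points D = cball (centre D) (radius D)"

definition packing :: "disc set \<Rightarrow> bool" where
  "packing P \<longleftrightarrow>
     (\<forall>D\<in>P. radius D > 0) \<and>
     pairwise (\<lambda>D E. disjnt (interior (disc_points D)) (interior (disc_points E))) P"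

text \<open>External tangency, the only kind possible between discs with disjoint interiors.\<close>

definition tangent :: "disc \<Rightarrow> disc \<Rightarrow> bool" where
  "tangent D E \<longleftrightarrow> dist (centre D) (centre E) = radius D + radius E"

definition angle_at :: "complex \<Rightarrow> complex \<Rightarrow> complex \<Rightarrow> real" where
  "angle_at m a b = arccos (((a - m) \<bullet> (b - m)) / (norm (a - m) * norm (b - m)))"

text \<open>
  Counterclockwise order around \<open>D\<close>, starting from the direction of the positive real axis.
  The conditions imposed below on such a list are invariant under rotation and reversal of the
  list, so neither the starting direction nor the orientation matters.
\<close>

definition cyclically_ordered :: "disc \<Rightarrow> disc list \<Rightarrow> bool" where
  "cyclically_ordered D Ds \<longleftrightarrow>
     sorted_wrt (\<lambda>E F. Arg2pi (centre E - centre D) < Arg2pi (centre F - centre D)) Ds"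

definition surrounds :: "disc list \<Rightarrow> disc \<Rightarrow> bool" where
  "surrounds Ds D \<longleftrightarrow>
     (let n = length Ds;
          next_disc = (\<lambda>i. Ds ! (Suc i mod n));
          \<theta> = (\<lambda>i. angle_at (centre D) (centre (Ds ! i)) (centre (next_disc i)))
      in (\<forall>i<n. tangent (Ds ! i) (next_disc i)) \<and>
         (\<forall>i<n. 0 < \<theta> i \<and> \<theta> i < pi) \<and>
         (\<Sum>i<n. \<theta> i) = 2 * pi)"

definition compact_packing :: "disc set \<Rightarrow> bool" where
  "compact_packing P \<longleftrightarrow>
     packing P \<and>
     (\<forall>D\<in>P. \<exists>Ds. set Ds = {E \<in> P. tangent D E} \<and> cyclically_ordered D Ds \<and> surrounds Ds D)"

definition compact_packing_using :: "real set \<Rightarrow> disc set \<Rightarrow> bool" where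
  "compact_packing_using R P \<longleftrightarrow> compact_packing P \<and> radius ` P = R"

definition is_square :: "real \<Rightarrow> complex set \<Rightarrow> bool" where
  "is_square s S \<longleftrightarrow>
     (\<exists>a u v. norm u = s \<and> norm v = s \<and> u \<bullet> v = 0 \<and>
        S = convex hull {a, a + u, a + u + v, a + v})"

definition is_equilateral_triangle :: "real \<Rightarrow> complex set \<Rightarrow> bool" where
  "is_equilateral_triangle s S \<longleftrightarrow>
     (\<exists>a b c. dist a b = s \<and> dist b c = s \<and> dist c a = s \<and> S = convex hull {a, b, c})"

text \<open>
  Tilings are edge-to-edge: two tiles meet, if at all, in a common vertex or a common edge.
  Without this requirement a vertex may lie inside an edge of another tile, and the discs
  of radius 1 centred at the vertices would overlap.
\<close>

definition square_triangle_tiling :: "complex set set \<Rightarrow> bool" where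
  "square_triangle_tiling T \<longleftrightarrow>
     (\<forall>S\<in>T. is_square 2 S \<or> is_equilateral_triangle 2 S) \<and>
     \<Union>T = UNIV \<and>
     pairwise (\<lambda>S S'. disjnt (interior S) (interior S')) T \<and>
     pairwise (\<lambda>S S'. (S \<inter> S') face_of S \<and> (S \<inter> S') face_of S') T"

definition vertices :: "complex set \<Rightarrow> complex set" where
  "vertices S = {x. x extreme_point_of S}"

definition polygon_centre :: "complex set \<Rightarrow> complex" where
  "polygon_centre S = (\<Sum>x\<in>vertices S. x) /\<^sub>R real (card (vertices S))"

definition drawn_segments :: "disc set \<Rightarrow> complex set" where
  "drawn_segments P =
     \<Union>{closed_segment (centre D) (centre E) | D E.
         D \<in> P \<and> E \<in> P \<and> radius D = 1 \<and> radius E = 1 \<and> tangent D E}"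

text \<open>The tiles are the closed regions into which the drawn segments divide the plane.\<close>

definition tiling_of_packing :: "disc set \<Rightarrow> complex set set" where
  "tiling_of_packing P = closure ` components (- drawn_segments P)"

definition packing_of_tiling :: "real \<Rightarrow> complex set set \<Rightarrow> disc set" where
  "packing_of_tiling r T =
     {(x, 1) | x S. S \<in> T \<and> x \<in> vertices S} \<union>
     {(polygon_centre S, r) | S. S \<in> T \<and> is_square 2 S}"

end

theory Submission
  imports Defs
begin

text \<open>
  Both sides are encoded by the set \<open>A\<close> of centres of the discs of radius \<open>1\<close>, whose points are at
  least \<open>2\<close> apart.  All squares and equilateral triangles of side \<open>2\<close> with corners in such a set are
  Delaunay cells of it, hence meet edge to edge; they form a tiling as soon as they cover the plane,
  and every tiling arises in this way from its vertices.

  In a compact packing, four large discs or six small ones surround a small disc, because no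
  other combination of the angles \<open>\<pi> / 2\<close>, \<open>\<pi> / 3\<close> and \<open>arccos (1 - \<surd>2 / 2)\<close> adds up to \<open>2 \<pi>\<close>, and the
  second case would exclude large discs altogether.  The triangles formed by a large disc and two
  consecutive neighbours therefore are tiles or quarters of squares.  They cover the plane, since a
  point lies in one of those at its nearest large centre.  Conversely, given a covering by tiles, the
  neighbours of a disc inherit their cyclic order from the tiles around its centre.
\<close>

section \<open>Delaunay cells\<close>

text \<open>\<open>tiles A\<close> takes every tile on \<open>A\<close>, with no selection. This is
  possible because separation alone makes the circumscribed circles empty, and cells of empty
  circles cannot overlap. A covering subfamily of \<open>tiles A\<close> is therefore all of it;
  this is also what puts a small disc into every square on the large centres. The number
  \<open>r\<close> enters through \<open>1 + r = sqrt 2\<close>, half the diagonal of a square of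
  side 2. For a given tiling the obstacle is that the edge-to-edge condition speaks of tiles that
  meet, whereas separation compares vertices whose tiles need not; local finiteness supplies tiles
  that do meet. Compactness is stated by lists and unoriented angles. It is exchanged, in both
  directions, for a successor relation: each neighbour has a next one, reached by a counterclockwise
  turn of less than pi. The values of angles matter only around a small disc; elsewhere positions
  are expressed by nonnegative coordinates in a cone and distances by inner products, so that most
  claims become linear inequalities in these coordinates.\<close>

definition separated :: "complex set \<Rightarrow> bool" where
  "separated A \<longleftrightarrow> (\<forall>x\<in>A. \<forall>y\<in>A. x \<noteq> y \<longrightarrow> 2 \<le> dist x y)"

text \<open>A Delaunay cell: \<open>m\<close> is the centre of an empty circle and \<open>k\<close>
  its squared radius. Single points and edges are cells too, so one intersection lemma serves tiles,
  edges and vertices. Squared distances are used because two of them differ by an affine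
  function.\<close>

definition cell :: "complex set \<Rightarrow> complex set \<Rightarrow> bool" where
  "cell A V \<longleftrightarrow> finite V \<and> V \<noteq> {} \<and>
     (\<exists>m k. (\<forall>x\<in>A. k \<le> (x - m) \<bullet> (x - m)) \<and> V = {x \<in> A. (x - m) \<bullet> (x - m) = k})"

definition square_corners :: "complex set \<Rightarrow> bool" where
  "square_corners V \<longleftrightarrow> (\<exists>a u v. u \<bullet> u = 4 \<and> v \<bullet> v = 4 \<and> u \<bullet> v = 0 \<and>
     V = {a, a + u, a + u + v, a + v})"

definition triangle_corners :: "complex set \<Rightarrow> bool" where
  "triangle_corners V \<longleftrightarrow> (\<exists>a u v. u \<bullet> u = 4 \<and> v \<bullet> v = 4 \<and> u \<bullet> v = 2 \<and>
     V = {a, a + u, a + v})"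

abbreviation tile_corners :: "complex set \<Rightarrow> bool" where
  "tile_corners V \<equiv> square_corners V \<or> triangle_corners V"

definition tiles :: "complex set \<Rightarrow> complex set set" where
  "tiles A = {convex hull V | V. V \<subseteq> A \<and> tile_corners V}"

lemma norm_eq_2_iff: "norm x = 2 \<longleftrightarrow> x \<bullet> x = (4::real)" for x :: "'a::real_inner"
  by (auto simp: norm_eq_sqrt_inner real_sqrt_eq_iff[of _ 4, simplified])

lemma norm_ge_2_iff: "2 \<le> norm x \<longleftrightarrow> 4 \<le> x \<bullet> x" for x :: "'a::real_inner"
  by (auto simp: norm_eq_sqrt_inner real_sqrt_le_iff[of 4, simplified])

lemma norm_eq_sqrt2_iff: "norm x = sqrt 2 \<longleftrightarrow> x \<bullet> x = 2" for x :: "'a::real_inner"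
  by (auto simp: norm_eq_sqrt_inner)

lemma separatedD:
  assumes "separated A" "x \<in> A" "y \<in> A" "x \<noteq> y"
  shows "4 \<le> (x - y) \<bullet> (x - y)"
  using assms by (auto simp: separated_def dist_norm norm_ge_2_iff)

lemma is_square_2_iff: "is_square 2 S \<longleftrightarrow> (\<exists>V. square_corners V \<and> S = convex hull V)"
  unfolding is_square_def square_corners_def norm_eq_2_iff by auto

lemma is_equilateral_triangle_2_iff:
  "is_equilateral_triangle 2 S \<longleftrightarrow> (\<exists>V. triangle_corners V \<and> S = convex hull V)" (is "?l \<longleftrightarrow> ?r")
proof
  assume ?l
  then obtain a b c where abc: "dist a b = 2" "dist b c = 2" "dist c a = 2"
    and S: "S = convex hull {a, b, c}"
    by (auto simp: is_equilateral_triangle_def)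
  define u v where "u = b - a" and "v = c - a"
  have "u \<bullet> u = 4" "v \<bullet> v = 4" "(u - v) \<bullet> (u - v) = 4"
    using abc by (auto simp: dist_norm norm_eq_2_iff u_def v_def norm_minus_commute simp flip: norm_eq_2_iff)
  moreover have "u \<bullet> v = 2"
    using calculation by (simp add: inner_diff inner_commute)
  moreover have "{a, b, c} = {a, a + u, a + v}"
    by (simp add: u_def v_def)
  ultimately show ?r
    unfolding triangle_corners_def S by metis
next
  assume ?r
  then obtain a u v where uv: "u \<bullet> u = 4" "v \<bullet> v = 4" "u \<bullet> v = 2"
    and S: "S = convex hull {a, a + u, a + v}"
    by (auto simp: triangle_corners_def)
  have "dist a (a + u) = 2" "dist (a + u) (a + v) = 2" "dist (a + v) a = 2"
    using uv by (auto simp: dist_norm norm_eq_2_iff inner_diff inner_commute)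
  then show ?l
    unfolding is_equilateral_triangle_def S by metis
qed

lemma tiles_iff: "S \<in> tiles A \<longleftrightarrow> (\<exists>V. V \<subseteq> A \<and> tile_corners V \<and> S = convex hull V)"
  by (auto simp: tiles_def)

text \<open>The difference of the powers of a point with respect to two circles is an affine function.
  For two empty circles it is nonpositive on the first cell and nonnegative on the second, and it
  vanishes at exactly those corners of either cell that lie on both circles.\<close>

lemma cell_Int:
  assumes "cell A V" "cell A W"
  shows "convex hull V \<inter> convex hull W = convex hull (V \<inter> W)"
    and "(convex hull V \<inter> convex hull W) face_of (convex hull V)"
proof -
  obtain m k where V: "\<And>x. x \<in> A \<Longrightarrow> k \<le> (x - m) \<bullet> (x - m)" "V = {x \<in> A. (x - m) \<bullet> (x - m) = k}"
    and fV: "finite V"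
    using assms(1) by (auto simp: cell_def)
  obtain n l where W: "\<And>x. x \<in> A \<Longrightarrow> l \<le> (x - n) \<bullet> (x - n)" "W = {x \<in> A. (x - n) \<bullet> (x - n) = l}"
    using assms(2) by (auto simp: cell_def)
  define d where "d = n - m"
  define c where "c = (k - l + n \<bullet> n - m \<bullet> m) / 2"
  define H where "H = {x. d \<bullet> x = c}"
  have power: "((x - m) \<bullet> (x - m) - k) - ((x - n) \<bullet> (x - n) - l) = 2 * (d \<bullet> x - c)" for x
    by (simp add: d_def c_def inner_diff inner_commute field_simps)
  have Vle: "d \<bullet> x \<le> c" if "x \<in> V" for x
    using power[of x] V W(1)[of x] that by auto
  have Wge: "d \<bullet> x \<ge> c" if "x \<in> W" for x
    using power[of x] W V(1)[of x] that by auto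
  have hV: "d \<bullet> x \<le> c" if "x \<in> convex hull V" for x
    using that hull_minimal[of V "{x. d \<bullet> x \<le> c}" convex] Vle
    by (auto simp: convex_halfspace_le)
  have hW: "d \<bullet> x \<ge> c" if "x \<in> convex hull W" for x
    using that hull_minimal[of W "{x. d \<bullet> x \<ge> c}" convex] Wge
    by (auto simp: convex_halfspace_ge)
  have VH: "V \<inter> H = V \<inter> W"
    using power V(2) W(2) by (auto simp: H_def) (smt (verit))+
  have face: "(convex hull V \<inter> H) face_of convex hull V" "(convex hull W \<inter> H) face_of convex hull W"
    unfolding H_def
    using face_of_Int_supporting_hyperplane_le[OF convex_convex_hull hV]
      face_of_Int_supporting_hyperplane_ge[OF convex_convex_hull hW] by auto
  have cut: "convex hull U \<inter> H \<subseteq> convex hull (U \<inter> H)"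
    if U: "finite U" and fac: "(convex hull U \<inter> H) face_of convex hull U" for U
  proof -
    obtain U' where "U' \<subseteq> U" "convex hull U \<inter> H = convex hull U'"
      using face_of_convex_hull_subset[OF finite_imp_compact[OF U] fac] by blast
    moreover have "U' \<subseteq> H"
      using calculation hull_subset[of U' convex] by auto
    ultimately show ?thesis
      by (metis Int_subset_iff hull_mono)
  qed
  have "convex hull V \<inter> H = convex hull (V \<inter> W)"
  proof
    show "convex hull V \<inter> H \<subseteq> convex hull (V \<inter> W)"
      using cut[OF fV face(1)] VH by simp
    show "convex hull (V \<inter> W) \<subseteq> convex hull V \<inter> H"
    proof -
      have "convex hull (V \<inter> W) \<subseteq> H"
        using VH by (intro hull_minimal) (auto simp: H_def convex_hyperplane)
      then show ?thesis
        by (metis Int_subset_iff hull_mono inf_le1)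
    qed
  qed
  moreover have "convex hull V \<inter> convex hull W = convex hull V \<inter> H"
  proof
    show "convex hull V \<inter> convex hull W \<subseteq> convex hull V \<inter> H"
      using hV hW by (force simp: H_def)
    show "convex hull V \<inter> H \<subseteq> convex hull V \<inter> convex hull W"
      using calculation by (metis Int_lower1 Int_lower2 Int_subset_iff hull_mono)
  qed
  ultimately show "convex hull V \<inter> convex hull W = convex hull (V \<inter> W)"
    and "(convex hull V \<inter> convex hull W) face_of (convex hull V)"
    using face by auto
qed

lemma cell_point: "x \<in> A \<Longrightarrow> cell A {x}"
  unfolding cell_def
  by (intro conjI exI[of _ x] exI[of _ 0]) auto

text \<open>The circle with diameter from \<open>x\<close> to \<open>y\<close> is empty: the squared
  distances of \<open>z\<close> to \<open>x\<close> and \<open>y\<close> add up to twice its squared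
  distance to the midpoint plus 2. If both are at least 4, the latter is at least 3, beyond the
  squared radius 1.\<close>

lemma cell_edge:
  assumes A: "separated A" "x \<in> A" "y \<in> A" and d: "dist x y = 2"
  shows "cell A {x, y}"
  unfolding cell_def
proof (intro conjI exI[of _ "(x + y) /\<^sub>R 2"] exI[of _ 1])
  let ?m = "(x + y) /\<^sub>R 2"
  have xy: "(x - y) \<bullet> (x - y) = 4"
    using d by (simp add: dist_norm norm_eq_2_iff)
  have far: "1 < (z - ?m) \<bullet> (z - ?m)" if "z \<in> A" "z \<noteq> x" "z \<noteq> y" for z
    using separatedD[OF A(1) that(1) A(2) that(2)] separatedD[OF A(1) that(1) A(3) that(3)] xy
    by (simp add: inner_simps inner_commute) (simp add: field_simps)
  have near: "(z - ?m) \<bullet> (z - ?m) = 1" if "z = x \<or> z = y" for z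
    using xy that by (auto simp: inner_simps inner_commute) (simp_all add: field_simps)
  show "\<forall>z\<in>A. 1 \<le> (z - ?m) \<bullet> (z - ?m)" "{x, y} = {z \<in> A. (z - ?m) \<bullet> (z - ?m) = 1}"
    using far near A by (force simp: less_imp_le)+
qed auto

text \<open>Cramer's rule for the coordinates of \<open>d\<close> in the basis \<open>u\<close>,
  \<open>v\<close>, cleared of the Gram determinant; it rests on the plane having dimension two. For
  the sides of a square the determinant is 16, for those of a triangle 12.\<close>

lemma gram_decomposition:
  fixes d u v :: complex
  shows "((u \<bullet> u) * (v \<bullet> v) - (u \<bullet> v)\<^sup>2) *\<^sub>R d =
    ((d \<bullet> u) * (v \<bullet> v) - (d \<bullet> v) * (u \<bullet> v)) *\<^sub>R u + ((d \<bullet> v) * (u \<bullet> u) - (d \<bullet> u) * (u \<bullet> v)) *\<^sub>R v"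
  by (simp add: complex_eq_iff inner_complex_def) algebra

lemma square_decomposition:
  fixes d u v :: complex
  assumes "u \<bullet> u = 4" "v \<bullet> v = 4" "u \<bullet> v = 0"
  shows "d = ((d \<bullet> u) / 4) *\<^sub>R u + ((d \<bullet> v) / 4) *\<^sub>R v"
proof -
  have "16 *\<^sub>R d = 16 *\<^sub>R (((d \<bullet> u) / 4) *\<^sub>R u + ((d \<bullet> v) / 4) *\<^sub>R v)"
    using gram_decomposition[of u v d] assms by (simp add: scaleR_add_right mult.commute)
  then show ?thesis
    by simp
qed

lemma triangle_decomposition:
  fixes d u v :: complex
  assumes "u \<bullet> u = 4" "v \<bullet> v = 4" "u \<bullet> v = 2"
  shows "d = ((2 * (d \<bullet> u) - d \<bullet> v) / 6) *\<^sub>R u + ((2 * (d \<bullet> v) - d \<bullet> u) / 6) *\<^sub>R v"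
proof -
  have "12 *\<^sub>R d = (4 * (d \<bullet> u) - 2 * (d \<bullet> v)) *\<^sub>R u + (4 * (d \<bullet> v) - 2 * (d \<bullet> u)) *\<^sub>R v"
    using gram_decomposition[of u v d] assms by (simp add: mult.commute)
  then have "d = (1 / 12) *\<^sub>R ((4 * (d \<bullet> u) - 2 * (d \<bullet> v)) *\<^sub>R u + (4 * (d \<bullet> v) - 2 * (d \<bullet> u)) *\<^sub>R v)"
    by (metis divide_self_if scaleR_one scaleR_scaleR times_divide_eq_left zero_neq_numeral mult_1)
  also have "\<dots> = ((2 * (d \<bullet> u) - d \<bullet> v) / 6) *\<^sub>R u + ((2 * (d \<bullet> v) - d \<bullet> u) / 6) *\<^sub>R v"
    by (simp add: scaleR_add_right diff_divide_distrib)
  finally show ?thesis .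
qed

lemma square_inner_self:
  fixes d u v :: complex
  assumes "u \<bullet> u = 4" "v \<bullet> v = 4" "u \<bullet> v = 0"
  shows "4 * (d \<bullet> d) = (d \<bullet> u)\<^sup>2 + (d \<bullet> v)\<^sup>2"
  using arg_cong[OF square_decomposition[OF assms, of d], of "(\<bullet>) d"]
  by (simp add: inner_simps power2_eq_square)

text \<open>Opposite corners have squared distance 8, so by the parallelogram law squared distances
  of at least 4 to both force at least 2 to the centre \<open>m\<close>. The second part later
  recognises the corners among the points of \<open>A\<close> by their distance from the
  centre.\<close>

lemma square_circumcircle:
  assumes A: "separated A" and V: "{a, a + u, a + u + v, a + v} \<subseteq> A"
    and uv: "u \<bullet> u = 4" "v \<bullet> v = 4" "u \<bullet> v = 0" and m: "m = a + (u + v) /\<^sub>R 2" and x: "x \<in> A"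
  shows "2 \<le> (x - m) \<bullet> (x - m)"
    and "(x - m) \<bullet> (x - m) = 2 \<longleftrightarrow> x \<in> {a, a + u, a + u + v, a + v}"
proof -
  define d where "d = x - a"
  have xm: "(x - m) \<bullet> (x - m) = d \<bullet> d - d \<bullet> u - d \<bullet> v + 2"
    using uv by (simp add: m d_def inner_simps inner_commute)
  have near: "(x - m) \<bullet> (x - m) = 2" if "x \<in> {a, a + u, a + u + v, a + v}"
    using that uv unfolding m by (auto simp: inner_simps inner_commute)
  have far: "2 < (x - m) \<bullet> (x - m)" if "x \<notin> {a, a + u, a + u + v, a + v}"
  proof -
    have "4 \<le> d \<bullet> d" "4 \<le> (d - u) \<bullet> (d - u)" "4 \<le> (d - v) \<bullet> (d - v)" "4 \<le> (d - u - v) \<bullet> (d - u - v)"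
      using separatedD[OF A x, of a] separatedD[OF A x, of "a + u"] separatedD[OF A x, of "a + v"]
        separatedD[OF A x, of "a + u + v"] that V by (auto simp: d_def diff_diff_eq add.assoc add.commute)
    then have b: "4 \<le> d \<bullet> d" "2 * (d \<bullet> u) \<le> d \<bullet> d" "2 * (d \<bullet> v) \<le> d \<bullet> d"
      "2 * (d \<bullet> u) + 2 * (d \<bullet> v) \<le> d \<bullet> d + 4"
      using uv by (simp_all add: inner_simps inner_commute)
    \<comment> \<open>Equality would put \<open>x\<close> at distance exactly 2 from all four
      corners, hence at the centre, whose distance from them is only sqrt 2.\<close>
    have "d \<bullet> d - d \<bullet> u - d \<bullet> v \<noteq> 0"
    proof
      assume "d \<bullet> d - d \<bullet> u - d \<bullet> v = 0"
      with b have "d \<bullet> u = 2" "d \<bullet> v = 2" "d \<bullet> d = 4"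
        by linarith+
      then show False
        using square_inner_self[OF uv, of d] by simp
    qed
    then show ?thesis
      using b xm by linarith
  qed
  show "2 \<le> (x - m) \<bullet> (x - m)"
    "(x - m) \<bullet> (x - m) = 2 \<longleftrightarrow> x \<in> {a, a + u, a + u + v, a + v}"
    using near far by force+
qed

lemma cell_square:
  assumes A: "separated A" and V: "V \<subseteq> A" "square_corners V"
  shows "cell A V"
proof -
  obtain a u v where uv: "u \<bullet> u = 4" "v \<bullet> v = 4" "u \<bullet> v = 0" and Veq: "V = {a, a + u, a + u + v, a + v}"
    using V(2) by (auto simp: square_corners_def)
  define m where "m = a + (u + v) /\<^sub>R 2"
  note c = square_circumcircle[OF A V(1)[unfolded Veq] uv m_def]
  have "V = {x \<in> A. (x - m) \<bullet> (x - m) = 2}"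
    using c(2) V(1) unfolding Veq by blast
  moreover have "finite V" "V \<noteq> {}"
    by (simp_all add: Veq)
  ultimately show ?thesis
    unfolding cell_def using c(1) by metis
qed

text \<open>The squared distances of \<open>x\<close> to the three corners add up to 3 times its
  squared distance to the centroid \<open>m\<close> plus 4. A further point of \<open>A\<close> thus
  has squared distance at least 8/3 from \<open>m\<close>, against the squared circumradius
  4/3.\<close>

lemma cell_triangle:
  assumes A: "separated A" and V: "V \<subseteq> A" "triangle_corners V"
  shows "cell A V"
proof -
  obtain a u v where uv: "u \<bullet> u = 4" "v \<bullet> v = 4" "u \<bullet> v = 2" and Veq: "V = {a, a + u, a + v}"
    using V(2) by (auto simp: triangle_corners_def)
  define m where "m = a + (u + v) /\<^sub>R 3"
  have near: "(x - m) \<bullet> (x - m) = 4 / 3" if "x \<in> V" for x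
    using that uv unfolding Veq m_def
    by (auto simp: inner_simps inner_commute) (simp_all add: field_simps)
  have far: "4 / 3 < (x - m) \<bullet> (x - m)" if x: "x \<in> A" "x \<notin> V" for x
  proof -
    define d where "d = x - a"
    have "4 \<le> d \<bullet> d" "4 \<le> (d - u) \<bullet> (d - u)" "4 \<le> (d - v) \<bullet> (d - v)"
      using separatedD[OF A x(1), of a] separatedD[OF A x(1), of "a + u"] separatedD[OF A x(1), of "a + v"]
        x V by (auto simp: d_def diff_diff_eq Veq)
    moreover have "(x - m) \<bullet> (x - m) = d \<bullet> d - 2 / 3 * (d \<bullet> u) - 2 / 3 * (d \<bullet> v) + 4 / 3"
      using uv by (simp add: m_def d_def inner_simps inner_commute) (simp add: field_simps)
    ultimately show ?thesis
      using uv by (simp add: inner_simps inner_commute)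
  qed
  have "x \<in> V" if "x \<in> A" "(x - m) \<bullet> (x - m) = 4 / 3" for x
    using far[of x] that by (cases "x \<in> V") auto
  then have "V = {x \<in> A. (x - m) \<bullet> (x - m) = 4 / 3}"
    using near V(1) by blast
  moreover have "\<forall>x\<in>A. 4 / 3 \<le> (x - m) \<bullet> (x - m)"
    using near far by (metis less_imp_le order_refl)
  moreover have "finite V" "V \<noteq> {}"
    by (simp_all add: Veq)
  ultimately show ?thesis
    unfolding cell_def by (intro conjI exI[of _ m] exI[of _ "4 / 3"])
qed

lemma cell_tile: "separated A \<Longrightarrow> V \<subseteq> A \<Longrightarrow> tile_corners V \<Longrightarrow> cell A V"
  using cell_square cell_triangle by blast

text \<open>The singleton \<open>{x}\<close> is a cell as well, so it meets the hull in a face, and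
  a one-point face is an extreme point.\<close>

lemma cell_vertices:
  assumes "cell A V"
  shows "vertices (convex hull V) = V"
proof
  show "vertices (convex hull V) \<subseteq> V"
    by (auto simp: vertices_def intro: extreme_point_of_convex_hull)
  show "V \<subseteq> vertices (convex hull V)"
  proof
    fix x assume x: "x \<in> V"
    moreover have "V \<subseteq> A"
      using assms by (auto simp: cell_def)
    ultimately have "(convex hull V \<inter> convex hull {x}) face_of convex hull V"
      using cell_Int(2)[OF assms cell_point] by blast
    moreover have "convex hull V \<inter> convex hull {x} = {x}"
      using x hull_inc[of x V convex] by auto
    ultimately show "x \<in> vertices (convex hull V)"
      by (simp add: vertices_def face_of_singleton)
  qed
qed

lemma separated_tile_corners: "tile_corners V \<Longrightarrow> separated V"
  unfolding square_corners_def triangle_corners_def separated_def dist_norm norm_ge_2_iff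
  by (auto simp: inner_simps inner_commute)

text \<open>Corners are separated among themselves, so a tile is a cell with \<open>A\<close> taken
  to be \<open>V\<close> itself. Hence the point set of a tile determines its corners.\<close>

lemma vertices_tile: "tile_corners V \<Longrightarrow> vertices (convex hull V) = V"
  using cell_vertices[OF cell_tile[OF separated_tile_corners]] by blast

lemma convex_hull_square:
  fixes a u v :: "'a::real_vector"
  shows "convex hull {a, a + u, a + u + v, a + v} =
    {a + s *\<^sub>R u + t *\<^sub>R v | s t. 0 \<le> s \<and> s \<le> 1 \<and> 0 \<le> t \<and> t \<le> 1}" (is "?H = ?Q")
proof
  have "convex ?Q"
  proof (rule convexI)
    fix x y and p q :: real
    assume "x \<in> ?Q" "y \<in> ?Q" and pq: "0 \<le> p" "0 \<le> q" "p + q = 1"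
    then obtain s t s' t' where x: "x = a + s *\<^sub>R u + t *\<^sub>R v" "0 \<le> s" "s \<le> 1" "0 \<le> t" "t \<le> 1"
      and y: "y = a + s' *\<^sub>R u + t' *\<^sub>R v" "0 \<le> s'" "s' \<le> 1" "0 \<le> t'" "t' \<le> 1"
      by blast
    have "p *\<^sub>R x + q *\<^sub>R y = a + (p * s + q * s') *\<^sub>R u + (p * t + q * t') *\<^sub>R v"
      using pq(3) by (simp add: x y algebra_simps flip: scaleR_add_left[of p q a])
    moreover have "p * s + q * s' \<le> 1" "p * t + q * t' \<le> 1"
      using convex_bound_le[of s 1 s' p q] convex_bound_le[of t 1 t' p q] x y pq by auto
    ultimately show "p *\<^sub>R x + q *\<^sub>R y \<in> ?Q"
      using x y pq by fastforce
  qed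
  moreover have "{a, a + u, a + u + v, a + v} \<subseteq> ?Q"
  proof -
    have "a + s *\<^sub>R u + t *\<^sub>R v \<in> ?Q" if "s \<in> {0, 1}" "t \<in> {0, 1}" for s t :: real
      using that by (intro CollectI exI[of _ s] exI[of _ t]) auto
    from this[of 0 0] this[of 1 0] this[of 1 1] this[of 0 1] show ?thesis
      by simp
  qed
  ultimately show "?H \<subseteq> ?Q"
    by (rule hull_minimal[rotated])
  show "?Q \<subseteq> ?H"
  proof
    fix x assume "x \<in> ?Q"
    then obtain s t where x: "x = a + s *\<^sub>R u + t *\<^sub>R v" and st: "0 \<le> s" "s \<le> 1" "0 \<le> t" "t \<le> 1"
      by blast
    have in_hull: "p *\<^sub>R y + q *\<^sub>R z \<in> ?H" if "y \<in> ?H" "z \<in> ?H" "0 \<le> p" "0 \<le> q" "p + q = 1" for y z p q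
      using convexD[OF convex_convex_hull] that by blast
    \<comment> \<open>The points at parameter \<open>s\<close> on two opposite sides;
      \<open>x\<close> divides the segment between them at parameter \<open>t\<close>.\<close>
    have y: "(1 - s) *\<^sub>R a + s *\<^sub>R (a + u) \<in> ?H" and z: "(1 - s) *\<^sub>R (a + v) + s *\<^sub>R (a + u + v) \<in> ?H"
      by (rule in_hull; use st in \<open>auto intro: hull_inc\<close>)+
    have "x = (1 - t) *\<^sub>R ((1 - s) *\<^sub>R a + s *\<^sub>R (a + u)) + t *\<^sub>R ((1 - s) *\<^sub>R (a + v) + s *\<^sub>R (a + u + v))"
      by (simp add: x algebra_simps)
    then show "x \<in> ?H"
      using in_hull[OF y z] st by simp
  qed
qed

lemma convex_hull_triangle:
  fixes a u v :: "'a::real_vector"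
  shows "convex hull {a, a + u, a + v} =
    {a + s *\<^sub>R u + t *\<^sub>R v | s t. 0 \<le> s \<and> 0 \<le> t \<and> s + t \<le> 1}"
  by (simp add: convex_hull_3_alt)

section \<open>Geometry of a single tile\<close>

lemma square_corner:
  assumes "square_corners V" "x \<in> V"
  obtains u v where "u \<bullet> u = 4" "v \<bullet> v = 4" "u \<bullet> v = 0" "V = {x, x + u, x + u + v, x + v}"
proof -
  obtain a u v where uv: "u \<bullet> u = 4" "v \<bullet> v = 4" "u \<bullet> v = 0"
    and V: "V = {a, a + u, a + u + v, a + v}"
    using assms(1) by (auto simp: square_corners_def)
  from assms(2) consider "x = a" | "x = a + u" | "x = a + u + v" | "x = a + v"
    unfolding V by blast
  then show ?thesis
  proof cases
    case 1
    then show ?thesis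
      using that[of u v] uv V by simp
  next
    case 2
    then show ?thesis
      using that[of "- u" v] uv V by (simp add: insert_commute algebra_simps)
  next
    case 3
    then show ?thesis
      using that[of "- u" "- v"] uv V by (simp add: insert_commute algebra_simps)
  next
    case 4
    then show ?thesis
      using that[of u "- v"] uv V by (simp add: insert_commute algebra_simps)
  qed
qed

lemma triangle_corner:
  assumes "triangle_corners V" "x \<in> V"
  obtains u v where "u \<bullet> u = 4" "v \<bullet> v = 4" "u \<bullet> v = 2" "V = {x, x + u, x + v}"
proof -
  obtain a u v where uv: "u \<bullet> u = 4" "v \<bullet> v = 4" "u \<bullet> v = 2" and V: "V = {a, a + u, a + v}"
    using assms(1) by (auto simp: triangle_corners_def)
  from assms(2) consider "x = a" | "x = a + u" | "x = a + v"
    unfolding V by blast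
  then show ?thesis
  proof cases
    case 1
    then show ?thesis
      using that[of u v] uv V by simp
  next
    case 2
    then show ?thesis
      using that[of "- u" "v - u"] uv V
      by (simp add: insert_commute inner_simps inner_commute)
  next
    case 3
    then show ?thesis
      using that[of "u - v" "- v"] uv V
      by (simp add: insert_commute inner_simps inner_commute)
  qed
qed

text \<open>Near a corner a tile coincides with the angle that it spans there, up to the sides not
  through that corner. These are at distance 2 in a square and sqrt 3, the height, in a triangle;
  the bound 3 is the smaller of the two squared.\<close>

lemma tile_star_shaped:
  assumes V: "tile_corners V" "x \<in> V" and e: "0 < e" "x + e *\<^sub>R d \<in> convex hull V" and d: "d \<bullet> d \<le> 3"
  shows "x + d \<in> convex hull V"
  using V(1)
proof
  assume "square_corners V"
  then obtain u v where uv: "u \<bullet> u = 4" "v \<bullet> v = 4" "u \<bullet> v = 0" and Veq: "V = {x, x + u, x + u + v, x + v}"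
    using V(2) by (rule square_corner)
  obtain s t where st: "0 \<le> s" "0 \<le> t" "x + e *\<^sub>R d = x + s *\<^sub>R u + t *\<^sub>R v"
    using e(2) unfolding Veq convex_hull_square by blast
  define s' t' where "s' = s / e" and "t' = t / e"
  have "e *\<^sub>R d = e *\<^sub>R (s' *\<^sub>R u + t' *\<^sub>R v)"
    using st(3) e(1) by (simp add: s'_def t'_def scaleR_add_right add.assoc)
  then have deq: "d = s' *\<^sub>R u + t' *\<^sub>R v"
    using e(1) by simp
  have "d \<bullet> d = 4 * s'\<^sup>2 + 4 * t'\<^sup>2"
    using uv by (simp add: deq inner_simps inner_commute power2_eq_square algebra_simps)
  then have "4 * s'\<^sup>2 + 4 * t'\<^sup>2 \<le> 3"
    using d by simp
  then have "s'\<^sup>2 \<le> 1" "t'\<^sup>2 \<le> 1"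
    using zero_le_power2[of s'] zero_le_power2[of t'] by linarith+
  then have "s' \<le> 1" "t' \<le> 1"
    using abs_square_le_1[of s'] abs_square_le_1[of t'] by linarith+
  moreover have "0 \<le> s'" "0 \<le> t'"
    using st e by (simp_all add: s'_def t'_def)
  ultimately show ?thesis
    unfolding Veq convex_hull_square deq by (auto simp: add.assoc)
next
  assume "triangle_corners V"
  then obtain u v where uv: "u \<bullet> u = 4" "v \<bullet> v = 4" "u \<bullet> v = 2" and Veq: "V = {x, x + u, x + v}"
    using V(2) by (rule triangle_corner)
  obtain s t where st: "0 \<le> s" "0 \<le> t" "x + e *\<^sub>R d = x + s *\<^sub>R u + t *\<^sub>R v"
    using e(2) unfolding Veq convex_hull_triangle by blast
  define s' t' where "s' = s / e" and "t' = t / e"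
  have "e *\<^sub>R d = e *\<^sub>R (s' *\<^sub>R u + t' *\<^sub>R v)"
    using st(3) e(1) by (simp add: s'_def t'_def scaleR_add_right add.assoc)
  then have deq: "d = s' *\<^sub>R u + t' *\<^sub>R v"
    using e(1) by simp
  \<comment> \<open>Orthogonal splitting along \<open>u + v\<close> and \<open>u - v\<close>, whose
    halves have squared lengths 3 (the height) and 1 (half of the opposite side).\<close>
  have "d \<bullet> d = 3 * (s' + t')\<^sup>2 + (s' - t')\<^sup>2"
    using uv by (simp add: deq inner_simps inner_commute power2_eq_square algebra_simps)
  then have "(s' + t')\<^sup>2 \<le> 1"
    using d zero_le_power2[of "s' - t'"] by linarith
  then have "s' + t' \<le> 1"
    using abs_square_le_1[of "s' + t'"] by linarith
  moreover have "0 \<le> s'" "0 \<le> t'"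
    using st e by (simp_all add: s'_def t'_def)
  ultimately show ?thesis
    unfolding Veq convex_hull_triangle deq by (auto simp: add.assoc)
qed

lemma ball_subset_square:
  assumes uv: "u \<bullet> u = 4" "v \<bullet> v = 4" "u \<bullet> v = 0"
  shows "ball (a + (u + v) /\<^sub>R 2) 1 \<subseteq> convex hull {a, a + u, a + u + v, a + v :: complex}"
proof
  fix x assume x: "x \<in> ball (a + (u + v) /\<^sub>R 2) 1"
  define d where "d = x - (a + (u + v) /\<^sub>R 2)"
  have d: "norm d < 1"
    using x by (simp add: d_def dist_norm norm_minus_commute)
  have n: "norm u = 2" "norm v = 2"
    using uv by (simp_all add: norm_eq_2_iff)
  have "\<bar>d \<bullet> u\<bar> \<le> norm d * 2" "\<bar>d \<bullet> v\<bar> \<le> norm d * 2"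
    using Cauchy_Schwarz_ineq2[of d u] Cauchy_Schwarz_ineq2[of d v] n by simp_all
  then have "\<bar>d \<bullet> u\<bar> \<le> 2" "\<bar>d \<bullet> v\<bar> \<le> 2"
    using d by linarith+
  moreover have "x = a + (1 / 2 + (d \<bullet> u) / 4) *\<^sub>R u + (1 / 2 + (d \<bullet> v) / 4) *\<^sub>R v"
  proof -
    have "x = a + (u + v) /\<^sub>R 2 + d"
      by (simp add: d_def)
    also have "\<dots> = a + (u + v) /\<^sub>R 2 + (((d \<bullet> u) / 4) *\<^sub>R u + ((d \<bullet> v) / 4) *\<^sub>R v)"
      using square_decomposition[OF uv, of d] by simp
    finally show ?thesis
      by (simp add: scaleR_add_left scaleR_add_right)
  qed
  ultimately show "x \<in> convex hull {a, a + u, a + u + v, a + v}"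
    unfolding convex_hull_square
    by (intro CollectI exI[of _ "1 / 2 + (d \<bullet> u) / 4"] exI[of _ "1 / 2 + (d \<bullet> v) / 4"]) auto
qed

lemma ball_subset_triangle:
  assumes uv: "u \<bullet> u = 4" "v \<bullet> v = 4" "u \<bullet> v = 2"
  shows "ball (a + (u + v) /\<^sub>R 3) (1 / 2) \<subseteq> convex hull {a, a + u, a + v :: complex}"
proof
  fix x assume x: "x \<in> ball (a + (u + v) /\<^sub>R 3) (1 / 2)"
  define d where "d = x - (a + (u + v) /\<^sub>R 3)"
  have "norm d < 1 / 2"
    using x by (simp add: d_def dist_norm norm_minus_commute)
  \<comment> \<open>The barycentric coordinates change by pairings of \<open>d\<close> with
    \<open>2 u - v\<close>, \<open>2 v - u\<close> and \<open>u + v\<close> (up to the factor 6);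
    all three have squared length 12, and the coordinates of the centroid leave room for 2 in each
    pairing.\<close>
  have bound: "\<bar>d \<bullet> w\<bar> < 2" if "w \<bullet> w \<le> 16" for w
  proof -
    have "norm w \<le> 4"
      using that by (simp add: norm_eq_sqrt_inner real_le_lsqrt)
    then have "norm d * norm w \<le> norm d * 4"
      by (simp add: mult_left_mono)
    then show ?thesis
      using Cauchy_Schwarz_ineq2[of d w] \<open>norm d < 1 / 2\<close> by linarith
  qed
  define s t where "s = (2 * (d \<bullet> u) - d \<bullet> v) / 6" and "t = (2 * (d \<bullet> v) - d \<bullet> u) / 6"
  have "\<bar>d \<bullet> (2 *\<^sub>R u - v)\<bar> < 2" "\<bar>d \<bullet> (2 *\<^sub>R v - u)\<bar> < 2" "\<bar>d \<bullet> (u + v)\<bar> < 2"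
    by (rule bound; use uv in \<open>simp add: inner_simps inner_commute\<close>)+
  then have "0 \<le> 1 / 3 + s" "0 \<le> 1 / 3 + t" "(1 / 3 + s) + (1 / 3 + t) \<le> 1"
    by (auto simp: s_def t_def inner_simps abs_less_iff field_simps)
  moreover have "x = a + (1 / 3 + s) *\<^sub>R u + (1 / 3 + t) *\<^sub>R v"
  proof -
    have "x = a + (u + v) /\<^sub>R 3 + d"
      by (simp add: d_def)
    also have "\<dots> = a + (u + v) /\<^sub>R 3 + (s *\<^sub>R u + t *\<^sub>R v)"
      using triangle_decomposition[OF uv, of d] by (simp add: s_def t_def)
    finally show ?thesis
      by (simp add: scaleR_add_left scaleR_add_right)
  qed
  ultimately show "x \<in> convex hull {a, a + u, a + v}"
    unfolding convex_hull_triangle by blast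
qed

text \<open>The points with both coordinates strictly between 0 and 1 form an open set
  \<open>U\<close> inside the square, so a point off the interior has a coordinate equal to 0 or 1
  and lies on a side.\<close>

lemma square_boundary:
  assumes uv: "u \<bullet> u = 4" "v \<bullet> v = 4" "u \<bullet> v = 0"
    and x: "x \<in> convex hull {a, a + u, a + u + v, a + v :: complex}"
      "x \<notin> interior (convex hull {a, a + u, a + u + v, a + v})"
  shows "x \<in> closed_segment a (a + u) \<union> closed_segment a (a + v)
    \<union> closed_segment (a + u) (a + u + v) \<union> closed_segment (a + v) (a + u + v)"
proof -
  obtain s t where st: "0 \<le> s" "s \<le> 1" "0 \<le> t" "t \<le> 1" and xst: "x = a + s *\<^sub>R u + t *\<^sub>R v"
    using x(1) unfolding convex_hull_square by blast
  define U where "U = {y. 0 < (y - a) \<bullet> u \<and> (y - a) \<bullet> u < 4 \<and> 0 < (y - a) \<bullet> v \<and> (y - a) \<bullet> v < 4}"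
  have "open U"
    unfolding U_def by (intro open_Collect_conj open_Collect_less continuous_intros)
  moreover have "U \<subseteq> convex hull {a, a + u, a + u + v, a + v}"
  proof
    fix y assume "y \<in> U"
    moreover have "y = a + (((y - a) \<bullet> u) / 4) *\<^sub>R u + (((y - a) \<bullet> v) / 4) *\<^sub>R v"
      using square_decomposition[OF uv, of "y - a"] by (simp add: algebra_simps)
    ultimately show "y \<in> convex hull {a, a + u, a + u + v, a + v}"
      unfolding convex_hull_square U_def
      by (intro CollectI exI[of _ "((y - a) \<bullet> u) / 4"] exI[of _ "((y - a) \<bullet> v) / 4"]) auto
  qed
  ultimately have "x \<notin> U"
    using x(2) interior_maximal by blast
  moreover have "(x - a) \<bullet> u = 4 * s" "(x - a) \<bullet> v = 4 * t"
    using uv by (simp_all add: xst inner_simps inner_commute)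
  ultimately have "s = 0 \<or> s = 1 \<or> t = 0 \<or> t = 1"
    using st unfolding U_def by force
  moreover have "b + c *\<^sub>R w \<in> closed_segment b (b + w)" if "0 \<le> c" "c \<le> 1" for b w :: complex and c
    using that unfolding closed_segment_def by (intro CollectI exI[of _ c]) (simp add: algebra_simps)
  note this[of t a v] this[of t "a + u" v] this[of s a u] this[of s "a + v" u]
  ultimately show ?thesis
    using st unfolding xst by (auto simp: add_ac)
qed

lemma triangle_boundary:
  assumes uv: "u \<bullet> u = 4" "v \<bullet> v = 4" "u \<bullet> v = 2"
    and x: "x \<in> convex hull {a, a + u, a + v :: complex}" "x \<notin> interior (convex hull {a, a + u, a + v})"
  shows "x \<in> closed_segment a (a + u) \<union> closed_segment a (a + v) \<union> closed_segment (a + u) (a + v)"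
proof -
  obtain s t where st: "0 \<le> s" "0 \<le> t" "s + t \<le> 1" and xst: "x = a + s *\<^sub>R u + t *\<^sub>R v"
    using x(1) unfolding convex_hull_triangle by blast
  \<comment> \<open>In the coordinates \<open>s\<close>, \<open>t\<close> of \<open>y\<close> the
    conditions read \<open>0 < 6 * s\<close>, \<open>0 < 6 * t\<close> and
    \<open>6 * (s + t) < 6\<close>.\<close>
  define U where "U = {y. 0 < 2 * ((y - a) \<bullet> u) - (y - a) \<bullet> v \<and> 0 < 2 * ((y - a) \<bullet> v) - (y - a) \<bullet> u \<and>
     (y - a) \<bullet> u + (y - a) \<bullet> v < 6}"
  have "open U"
    unfolding U_def by (intro open_Collect_conj open_Collect_less continuous_intros)
  moreover have "U \<subseteq> convex hull {a, a + u, a + v}"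
  proof
    fix y assume "y \<in> U"
    define s t where "s = (2 * ((y - a) \<bullet> u) - (y - a) \<bullet> v) / 6" and "t = (2 * ((y - a) \<bullet> v) - (y - a) \<bullet> u) / 6"
    have "0 \<le> s" "0 \<le> t" "s + t \<le> 1"
      using \<open>y \<in> U\<close> by (auto simp: U_def s_def t_def field_simps)
    moreover have "y = a + s *\<^sub>R u + t *\<^sub>R v"
      using triangle_decomposition[OF uv, of "y - a"] by (simp add: s_def t_def algebra_simps)
    ultimately show "y \<in> convex hull {a, a + u, a + v}"
      unfolding convex_hull_triangle by blast
  qed
  ultimately have "x \<notin> U"
    using x(2) interior_maximal by blast
  moreover have "(x - a) \<bullet> u = 4 * s + 2 * t" "(x - a) \<bullet> v = 2 * s + 4 * t"
    using uv by (simp_all add: xst inner_simps inner_commute)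
  ultimately consider "s = 0" | "t = 0" | "s + t = 1"
    using st unfolding U_def by force
  moreover have seg: "b + c *\<^sub>R w \<in> closed_segment b (b + w)" if "0 \<le> c" "c \<le> 1" for b w :: complex and c
    using that unfolding closed_segment_def by (intro CollectI exI[of _ c]) (simp add: algebra_simps)
  ultimately show ?thesis
  proof cases
    case 1
    then show ?thesis
      using st seg[of t a v] by (simp add: xst)
  next
    case 2
    then show ?thesis
      using st seg[of s a u] by (simp add: xst)
  next
    case 3
    then have s: "s = 1 - t"
      by simp
    have "x = (a + u) + t *\<^sub>R (v - u)"
      unfolding xst s by (simp add: algebra_simps)
    then show ?thesis
      using st seg[of t "a + u" "v - u"] by simp
  qed
qed

lemma tile_boundary:
  assumes V: "tile_corners V" and x: "x \<in> convex hull V" "x \<notin> interior (convex hull V)"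
  obtains y z where "y \<in> V" "z \<in> V" "dist y z = 2" "x \<in> closed_segment y z"
  using V
proof
  assume "square_corners V"
  then obtain a u v where uv: "u \<bullet> u = 4" "v \<bullet> v = 4" "u \<bullet> v = 0" and Veq: "V = {a, a + u, a + u + v, a + v}"
    by (auto simp: square_corners_def)
  have "dist a (a + u) = 2" "dist a (a + v) = 2" "dist (a + u) (a + u + v) = 2" "dist (a + v) (a + u + v) = 2"
    using uv by (simp_all add: dist_norm norm_eq_2_iff)
  moreover have "x \<in> closed_segment a (a + u) \<union> closed_segment a (a + v)
    \<union> closed_segment (a + u) (a + u + v) \<union> closed_segment (a + v) (a + u + v)"
    using square_boundary[OF uv] x unfolding Veq by blast
  ultimately show thesis
    using that unfolding Veq by blast
next
  assume "triangle_corners V"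
  then obtain a u v where uv: "u \<bullet> u = 4" "v \<bullet> v = 4" "u \<bullet> v = 2" and Veq: "V = {a, a + u, a + v}"
    by (auto simp: triangle_corners_def)
  have "dist a (a + u) = 2" "dist a (a + v) = 2" "dist (a + u) (a + v) = 2"
    using uv by (simp_all add: dist_norm norm_eq_2_iff inner_simps inner_commute)
  moreover have "x \<in> closed_segment a (a + u) \<union> closed_segment a (a + v) \<union> closed_segment (a + u) (a + v)"
    using triangle_boundary[OF uv] x unfolding Veq by blast
  ultimately show thesis
    using that unfolding Veq by blast
qed

text \<open>One inner and one outer radius for both shapes, as needed for counting tiles near a
  point: the inradii are 1 and 1 / sqrt 3, the circumradii sqrt 2 and 2 / sqrt 3.\<close>

lemma tile_ball:
  assumes "tile_corners V"
  obtains m where "ball m (1 / 2) \<subseteq> convex hull V" "convex hull V \<subseteq> cball m 2"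
  using assms
proof
  assume "square_corners V"
  then obtain a u v where uv: "u \<bullet> u = 4" "v \<bullet> v = 4" "u \<bullet> v = 0" and Veq: "V = {a, a + u, a + u + v, a + v}"
    by (auto simp: square_corners_def)
  define m where "m = a + (u + v) /\<^sub>R 2"
  have "V \<subseteq> cball m 2"
    using uv unfolding Veq m_def
    by (auto simp: dist_norm norm_eq_sqrt_inner inner_simps inner_commute intro!: real_le_lsqrt)
  then have "convex hull V \<subseteq> cball m 2"
    by (simp add: hull_minimal)
  moreover have "ball m (1 / 2) \<subseteq> convex hull V"
    using ball_subset_square[OF uv, of a] unfolding Veq m_def by force
  ultimately show ?thesis
    using that by blast
next
  assume "triangle_corners V"
  then obtain a u v where uv: "u \<bullet> u = 4" "v \<bullet> v = 4" "u \<bullet> v = 2" and Veq: "V = {a, a + u, a + v}"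
    by (auto simp: triangle_corners_def)
  define m where "m = a + (u + v) /\<^sub>R 3"
  have "V \<subseteq> cball m 2"
    using uv unfolding Veq m_def
    by (auto simp: dist_norm norm_eq_sqrt_inner inner_simps inner_commute intro!: real_le_lsqrt)
  then have "convex hull V \<subseteq> cball m 2"
    by (simp add: hull_minimal)
  moreover have "ball m (1 / 2) \<subseteq> convex hull V"
    using ball_subset_triangle[OF uv, of a] unfolding Veq m_def by force
  ultimately show ?thesis
    using that by blast
qed

lemma interior_tile_nonempty: "tile_corners V \<Longrightarrow> interior (convex hull V) \<noteq> {}"
  by (metis tile_ball open_ball interior_maximal subset_empty ball_eq_empty divide_pos_pos not_le zero_less_numeral zero_less_one)

lemma polygon_centre_square:
  assumes "u \<bullet> u = 4" "v \<bullet> v = 4" "u \<bullet> v = 0"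
  shows "polygon_centre (convex hull {a, a + u, a + u + v, a + v}) = a + (u + v) /\<^sub>R 2"
proof -
  have "vertices (convex hull {a, a + u, a + u + v, a + v}) = {a, a + u, a + u + v, a + v}"
    by (rule vertices_tile) (use assms in \<open>auto simp: square_corners_def\<close>)
  moreover have "distinct [a, a + u, a + u + v, a + v]"
    using assms by (auto simp: eq_neg_iff_add_eq_0[symmetric] add.assoc)
  ultimately show ?thesis
    by (simp add: polygon_centre_def complex_eq_iff)
qed

section \<open>Tilings and the drawn segments\<close>

lemma tile_face_eq:
  fixes S :: "complex set"
  assumes "F face_of S" "x \<in> F" "x \<in> interior S"
  shows "F = S"
proof (rule ccontr)
  assume "F \<noteq> S"
  then show False
    using face_of_disjoint_interior[OF assms(1)] assms(2,3) by auto
qed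

lemma tiles_Int_face:
  assumes "separated A" "S \<in> tiles A" "S' \<in> tiles A"
  shows "(S \<inter> S') face_of S"
  using assms cell_Int(2) cell_tile unfolding tiles_iff by metis

text \<open>A face that contains an interior point is the whole convex set. So the common face is
  all of \<open>S\<close>, and then, by symmetry, all of \<open>S'\<close>.\<close>

lemma tiles_eqI:
  assumes A: "separated A" and S: "S \<in> tiles A" "S' \<in> tiles A" and x: "x \<in> interior S" "x \<in> S'"
  shows "S = S'"
proof -
  have "S \<inter> S' = S"
    using tile_face_eq[OF tiles_Int_face[OF A S]] x interior_subset by blast
  then have sub: "S \<subseteq> S'"
    by blast
  then have "x \<in> interior S'"
    using interior_mono x by blast
  then have "S' \<inter> S = S'"
    using tile_face_eq[OF tiles_Int_face[OF A S(2,1)]] x interior_subset by blast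
  then show ?thesis
    using sub by blast
qed

lemma is_tile_iff: "is_square 2 S \<or> is_equilateral_triangle 2 S \<longleftrightarrow> (\<exists>V. tile_corners V \<and> S = convex hull V)"
  by (auto simp: is_square_2_iff is_equilateral_triangle_2_iff)

lemma square_triangle_tiling_tiles:
  assumes A: "separated A" and cover: "\<Union>(tiles A) = UNIV"
  shows "square_triangle_tiling (tiles A)"
  unfolding square_triangle_tiling_def
proof (intro conjI cover)
  show "\<forall>S\<in>tiles A. is_square 2 S \<or> is_equilateral_triangle 2 S"
    unfolding is_tile_iff by (auto simp: tiles_iff)
  show "pairwise (\<lambda>S S'. disjnt (interior S) (interior S')) (tiles A)"
    using tiles_eqI[OF A] interior_subset unfolding pairwise_def disjnt_iff by blast
  show "pairwise (\<lambda>S S'. (S \<inter> S') face_of S \<and> (S \<inter> S') face_of S') (tiles A)"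
    using tiles_Int_face[OF A] by (metis (no_types, lifting) Int_commute pairwiseI)
qed

section \<open>Local finiteness of tilings and separation of their vertices\<close>

lemma finite_bounded_if_spread:
  fixes X :: "'a::euclidean_space set"
  assumes "bounded X" "0 < e" "\<And>x y. x \<in> X \<Longrightarrow> y \<in> X \<Longrightarrow> x \<noteq> y \<Longrightarrow> e \<le> dist x y"
  shows "finite X"
proof (rule ccontr)
  assume "infinite X"
  moreover have "closed X"
    using assms(2,3) by (intro discrete_imp_closed[of e]) force+
  ultimately obtain x where "x \<in> X" "x islimpt X"
    using assms(1) by (meson bounded_infinite_imp_islimpt closed_limpt order_refl)
  then show False
    using assms(2,3) unfolding islimpt_approachable by (metis not_le)
qed

lemma disjoint_balls_dist:
  fixes x y :: "'a::euclidean_space"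
  assumes "ball x r \<inter> ball y s = {}" "0 < r" "0 < s"
  shows "r + s \<le> dist x y"
proof (rule ccontr)
  \<comment> \<open>The point that divides the segment in the ratio \<open>r : s\<close> would lie
    in both balls if the centres were closer than \<open>r + s\<close>.\<close>
  define c where "c = r / (r + s)"
  assume "\<not> r + s \<le> dist x y"
  then have lt: "norm (y - x) < r + s"
    by (simp add: dist_norm norm_minus_commute)
  have c: "c * (r + s) = r" "(1 - c) * (r + s) = s" "0 < c" "0 < 1 - c"
    using assms(2,3) by (simp_all add: c_def field_simps)
  have "c * norm (y - x) < r" "(1 - c) * norm (y - x) < s"
    using mult_strict_left_mono[OF lt c(3)] mult_strict_left_mono[OF lt c(4)] c(1,2) by simp_all
  moreover have "y - (x + c *\<^sub>R (y - x)) = (1 - c) *\<^sub>R (y - x)"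
    by (simp add: algebra_simps)
  ultimately have "x + c *\<^sub>R (y - x) \<in> ball x r \<inter> ball y s"
    using c(3,4) by (simp add: dist_norm)
  then show False
    using assms(1) by blast
qed

locale tiling =
  fixes T :: "complex set set"
  assumes tiling: "square_triangle_tiling T"
begin

lemma tile: "S \<in> T \<Longrightarrow> \<exists>V. tile_corners V \<and> S = convex hull V"
  using tiling is_tile_iff unfolding square_triangle_tiling_def by blast

lemma face: "S \<in> T \<Longrightarrow> S' \<in> T \<Longrightarrow> (S \<inter> S') face_of S"
  using tiling tile unfolding square_triangle_tiling_def pairwise_def
  by (metis Int_absorb convex_convex_hull face_of_refl)

text \<open>Disjoint interiors keep the discs of radius 1/2 inside the tiles apart, so their centres
  \<open>m S\<close> are at distance at least 1. For tiles meeting the unit ball about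
  \<open>q\<close> they lie in the ball of radius 3, which leaves room for finitely many.\<close>

lemma locally_finite: "finite {S \<in> T. S \<inter> ball q 1 \<noteq> {}}" (is "finite ?F")
proof -
  have "\<exists>m. ball m (1 / 2) \<subseteq> S \<and> S \<subseteq> cball m 2" if "S \<in> T" for S
    using tile[OF that] tile_ball by metis
  then obtain m where m: "\<And>S. S \<in> T \<Longrightarrow> ball (m S) (1 / 2) \<subseteq> S" "\<And>S. S \<in> T \<Longrightarrow> S \<subseteq> cball (m S) 2"
    by metis
  have spread: "1 \<le> dist (m S) (m S')" if "S \<in> T" "S' \<in> T" "S \<noteq> S'" for S S'
  proof -
    have "ball (m S) (1 / 2) \<subseteq> interior S" "ball (m S') (1 / 2) \<subseteq> interior S'"
      using m(1) that by (simp_all add: interior_maximal)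
    moreover have "interior S \<inter> interior S' = {}"
      using tiling that unfolding square_triangle_tiling_def pairwise_def disjnt_def by blast
    ultimately have "ball (m S) (1 / 2) \<inter> ball (m S') (1 / 2) = {}"
      by blast
    then show ?thesis
      using disjoint_balls_dist by fastforce
  qed
  have "m ` ?F \<subseteq> ball q 3"
  proof
    fix p assume "p \<in> m ` ?F"
    then obtain S where S: "S \<in> T" "p = m S" and "S \<inter> ball q 1 \<noteq> {}"
      by blast
    then obtain y where y: "y \<in> S" "dist q y < 1"
      by auto
    then have "dist (m S) y \<le> 2"
      using m(2)[OF S(1)] by auto
    then show "p \<in> ball q 3"
      using y dist_triangle2[of q "m S" y] by (simp add: S)
  qed
  then have "bounded (m ` ?F)"
    using bounded_subset bounded_ball by blast
  moreover have "1 \<le> dist x y" if "x \<in> m ` ?F" "y \<in> m ` ?F" "x \<noteq> y" for x y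
    using that spread by blast
  ultimately have "finite (m ` ?F)"
    using finite_bounded_if_spread[of "m ` ?F" 1] by simp
  moreover have "inj_on m ?F"
    using spread by (force simp: inj_on_def)
  ultimately show ?thesis
    by (rule finite_imageD)
qed

lemma closed_tile: "S \<in> T \<Longrightarrow> closed S"
proof -
  assume "S \<in> T"
  then obtain V where V: "tile_corners V" "S = convex hull V"
    using tile by blast
  then have "finite V"
    by (auto simp: square_corners_def triangle_corners_def)
  then show "closed S"
    by (simp add: V finite_imp_compact_convex_hull compact_imp_closed)
qed

text \<open>Only finitely many closed tiles come near \<open>q\<close>, so some ball around
  \<open>q\<close> avoids all those that miss \<open>q\<close>. A short step from \<open>q\<close>
  stays in this ball, and any tile covering its end contains \<open>q\<close>.\<close>

lemma tile_in_direction: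
  obtains S e where "S \<in> T" "q \<in> S" "0 < e" "q + e *\<^sub>R d \<in> S"
proof -
  define F where "F = {S \<in> T. S \<inter> ball q 1 \<noteq> {}}"
  define U where "U = ball q 1 - \<Union>{S \<in> F. q \<notin> S}"
  have "open U"
    unfolding U_def F_def using closed_tile
    by (intro open_Diff open_ball closed_Union) (auto intro: finite_subset[OF _ locally_finite[of q]])
  moreover have "q \<in> U"
    by (simp add: U_def)
  ultimately obtain r where r: "0 < r" "ball q r \<subseteq> U"
    using openE by blast
  \<comment> \<open>The summand 1 keeps the denominator positive when \<open>d = 0\<close>.\<close>
  define e where "e = r / (norm d + 1)"
  have pos: "0 < norm d + 1"
    by (simp add: add_nonneg_pos)
  have "0 < e"
    using r pos by (simp add: e_def)
  moreover have "e * (norm d + 1) = r"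
    using pos by (simp add: e_def)
  then have "e * norm d + e = r"
    by (simp add: algebra_simps)
  ultimately have "e * norm d < r"
    by linarith
  then have "q + e *\<^sub>R d \<in> U"
    using r(2) \<open>0 < e\<close> by (auto simp: dist_norm)
  moreover obtain S where "S \<in> T" "q + e *\<^sub>R d \<in> S"
    using tiling unfolding square_triangle_tiling_def by blast
  ultimately have "q \<in> S"
    unfolding U_def F_def by blast
  then show ?thesis
    using that \<open>0 < e\<close> \<open>S \<in> T\<close> \<open>q + e *\<^sub>R d \<in> S\<close> by blast
qed

text \<open>This is where edge-to-edge excludes a vertex inside the edge of another tile: an extreme
  point of \<open>S\<close> is one of the common face, and an extreme point of a face of
  \<open>S'\<close> is one of \<open>S'\<close>.\<close>

lemma vertex_of_all:
  assumes "S \<in> T" "v \<in> vertices S" "S' \<in> T" "v \<in> S'"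
  shows "v \<in> vertices S'"
proof -
  have "v extreme_point_of S"
    using assms(2) by (simp add: vertices_def)
  moreover have "v \<in> S"
    using calculation by (simp add: extreme_point_of_def)
  ultimately have "v extreme_point_of (S \<inter> S')"
    using extreme_point_of_face[OF face[OF assms(1,3)]] assms(4) by blast
  then show ?thesis
    using extreme_point_of_face[OF face[OF assms(3,1)]] by (simp add: vertices_def Int_commute)
qed

text \<open>The tile entered from \<open>v\<close> in direction \<open>d\<close> has
  \<open>v\<close> as a corner, and near a corner a tile follows each ray that it contains up to
  length sqrt 3.\<close>

lemma tile_star:
  assumes "S \<in> T" "v \<in> vertices S" "d \<bullet> d \<le> 3"
  obtains S' where "S' \<in> T" "v \<in> S'" "v + d \<in> S'"
proof -
  obtain S' e where S': "S' \<in> T" "v \<in> S'" "0 < e" "v + e *\<^sub>R d \<in> S'"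
    by (rule tile_in_direction)
  then obtain V where V: "tile_corners V" "S' = convex hull V"
    using tile by blast
  then have "v \<in> V"
    using vertex_of_all[OF assms(1,2) S'(1,2)] vertices_tile by blast
  then show ?thesis
    using that[OF S'(1,2)] tile_star_shaped[OF V(1) _ S'(3)] S'(4) assms(3) V(2) by blast
qed

text \<open>For vertices \<open>v\<close>, \<open>w\<close> less than \<open>2\<close> apart, a tile at \<open>v\<close> and a tile at \<open>w\<close> each contain more
  than half of the segment between them.  The midpoint lies in their common face, which therefore
  contains both \<open>v\<close> and \<open>w\<close>.\<close>

lemma separated_vertices: "separated (\<Union>(vertices ` T))"
  unfolding separated_def
proof (intro ballI impI)
  fix v w assume "v \<in> \<Union>(vertices ` T)" "w \<in> \<Union>(vertices ` T)" and "v \<noteq> w"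
  then obtain Sv Sw where Sv: "Sv \<in> T" "v \<in> vertices Sv" and Sw: "Sw \<in> T" "w \<in> vertices Sw"
    by blast
  show "2 \<le> dist v w"
  proof (rule ccontr)
    assume "\<not> 2 \<le> dist v w"
    then have "norm (w - v) < 2"
      by (simp add: dist_norm norm_minus_commute)
    then have "norm (w - v) ^ 2 < 2 ^ 2"
      by (intro power_strict_mono) auto
    then have vw: "(w - v) \<bullet> (w - v) < 4"
      by (simp add: power2_norm_eq_inner)
    \<comment> \<open>The factor 3/4 carries both pieces past the midpoint, while their squared
      lengths, below (9/16) * 4, stay within the bound 3.\<close>
    have short: "((3 / 4) *\<^sub>R (w - v)) \<bullet> ((3 / 4) *\<^sub>R (w - v)) \<le> 3" "((3 / 4) *\<^sub>R (v - w)) \<bullet> ((3 / 4) *\<^sub>R (v - w)) \<le> 3"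
      using vw by (simp_all add: inner_diff inner_commute)
    obtain S where S: "S \<in> T" "v \<in> S" "v + (3 / 4) *\<^sub>R (w - v) \<in> S"
      using tile_star[OF Sv short(1)] .
    obtain S' where S': "S' \<in> T" "w \<in> S'" "w + (3 / 4) *\<^sub>R (v - w) \<in> S'"
      using tile_star[OF Sw short(2)] .
    define m where "m = midpoint v w"
    \<comment> \<open>Since 2/3 of 3/4 is 1/2, the midpoint is a relative interior point of the
      piece, as the face property requires.\<close>
    have mv: "m \<in> open_segment v (v + (3 / 4) *\<^sub>R (w - v))"
      unfolding open_segment_image_interval m_def midpoint_def using \<open>v \<noteq> w\<close>
      by (auto simp: algebra_simps complex_eq_iff intro!: image_eqI[of _ _ "2 / 3"])
    have mw: "m \<in> open_segment w (w + (3 / 4) *\<^sub>R (v - w))"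
      unfolding open_segment_image_interval m_def midpoint_def using \<open>v \<noteq> w\<close>
      by (auto simp: algebra_simps complex_eq_iff intro!: image_eqI[of _ _ "2 / 3"])
    have "convex S" "convex S'"
      using tile S(1) S'(1) by auto
    then have "m \<in> S" "m \<in> S'"
      using mv mw S S' convex_contains_open_segment closed_segment_subset segment_open_subset_closed by blast+
    then have "v \<in> S'" "w \<in> S"
      using face_ofD[OF face[OF S(1) S'(1)] mv] face_ofD[OF face[OF S'(1) S(1)] mw] S S' by blast+
    obtain V where V: "tile_corners V" "S = convex hull V"
      using tile S(1) by blast
    have "v \<in> V" "w \<in> V"
      using vertex_of_all[OF Sv S(1,2)] vertex_of_all[OF Sw S(1) \<open>w \<in> S\<close>] vertices_tile[OF V(1)] V(2) by auto
    then show False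
      using separated_tile_corners[OF V(1)] \<open>v \<noteq> w\<close> \<open>\<not> 2 \<le> dist v w\<close> by (auto simp: separated_def)
  qed
qed

end

text \<open>An interior point of a tile on \<open>A\<close> is covered by \<open>T\<close>, and the
  covering tile must be that same tile. This identifies a given tiling with \<open>tiles A\<close>,
  and likewise the tiles read off from a packing.\<close>

lemma subset_tiles_eq:
  assumes A: "separated A" and T: "T \<subseteq> tiles A" "\<Union>T = UNIV"
  shows "T = tiles A"
proof
  show "tiles A \<subseteq> T"
  proof
    fix S assume S: "S \<in> tiles A"
    then obtain x where x: "x \<in> interior S"
      using interior_tile_nonempty unfolding tiles_iff by blast
    obtain S' where S': "S' \<in> T" "x \<in> S'"
      using T(2) by blast
    then have "S = S'"
      using tiles_eqI[OF A S _ x] T(1) by blast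
    then show "S \<in> T"
      using S' by simp
  qed
qed (rule T(1))

lemma tiling_eq_tiles:
  assumes "square_triangle_tiling T"
  obtains A where "separated A" "T = tiles A"
proof -
  interpret tiling T
    by unfold_locales fact
  have "T \<subseteq> tiles (\<Union>(vertices ` T))"
  proof
    fix S assume S: "S \<in> T"
    then obtain V where "tile_corners V" "S = convex hull V"
      using tile by blast
    moreover have "V \<subseteq> \<Union>(vertices ` T)"
      using S calculation vertices_tile by blast
    ultimately show "S \<in> tiles (\<Union>(vertices ` T))"
      by (auto simp: tiles_iff)
  qed
  moreover have "\<Union>T = UNIV"
    using tiling unfolding square_triangle_tiling_def by blast
  ultimately show ?thesis
    using that separated_vertices subset_tiles_eq by blast
qed

text \<open>The segment is an edge cell, so it meets the tile in a face. If that face reached the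
  interior, the whole tile would lie in a segment, which has empty interior in the plane.\<close>

lemma segment_tile_interior:
  assumes A: "separated A" and S: "S \<in> tiles A" and yz: "y \<in> A" "z \<in> A" "dist y z = 2"
  shows "closed_segment y z \<inter> interior S = {}"
proof (rule ccontr)
  assume "closed_segment y z \<inter> interior S \<noteq> {}"
  then obtain x where x: "x \<in> closed_segment y z" "x \<in> interior S"
    by blast
  obtain V where V: "V \<subseteq> A" "tile_corners V" "S = convex hull V"
    using S by (auto simp: tiles_iff)
  have "(S \<inter> convex hull {y, z}) face_of S"
    using cell_Int(2)[OF cell_tile[OF A V(1,2)] cell_edge[OF A yz]] V by simp
  then have "S \<inter> convex hull {y, z} = S"
    using tile_face_eq[of _ S x] x interior_subset by (auto simp: segment_convex_hull)
  then have "interior S \<subseteq> interior (closed_segment y z)"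
    by (intro interior_mono) (auto simp: segment_convex_hull)
  then show False
    using x by (simp add: interior_closed_segment_ge2)
qed

text \<open>The interiors of the tiles are open, connected, nonempty and disjoint, and their union
  is exactly the complement of the segments; so they are its components. The closure of each gives
  back its tile.\<close>

lemma tiling_of_packing_eq_tiles:
  assumes A: "separated A" and cover: "\<Union>(tiles A) = UNIV" and P: "\<And>x. (x, 1) \<in> P \<longleftrightarrow> x \<in> A"
  shows "tiling_of_packing P = tiles A"
proof -
  define D where "D = \<Union>{closed_segment y z | y z. y \<in> A \<and> z \<in> A \<and> dist y z = 2}"
  have "drawn_segments P = D"
  proof -
    have "{closed_segment (centre D) (centre E) | D E.
         D \<in> P \<and> E \<in> P \<and> radius D = 1 \<and> radius E = 1 \<and> tangent D E} =
         {closed_segment y z | y z. y \<in> A \<and> z \<in> A \<and> dist y z = 2}"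
      using P by (fastforce simp: tangent_def)
    then show ?thesis
      by (simp add: drawn_segments_def D_def)
  qed
  have convex: "convex S" and nonempty: "interior S \<noteq> {}" and closed: "closure S = S" if S: "S \<in> tiles A" for S
  proof -
    obtain V where V: "tile_corners V" "S = convex hull V"
      using S unfolding tiles_iff by blast
    moreover from this have "finite V"
      by (auto simp: square_corners_def triangle_corners_def)
    ultimately show "convex S" "interior S \<noteq> {}" "closure S = S"
      by (simp_all add: interior_tile_nonempty finite_imp_compact_convex_hull compact_imp_closed)
  qed
  have "components (- D) = interior ` tiles A"
  proof (rule components_open_unique)
    show "pairwise disjnt (interior ` tiles A)"
      using tiles_eqI[OF A] interior_subset unfolding pairwise_def disjnt_iff by blast
    show "\<Union>(interior ` tiles A) = - D"
    proof
      show "\<Union>(interior ` tiles A) \<subseteq> - D"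
        using segment_tile_interior[OF A] unfolding D_def by blast
      show "- D \<subseteq> \<Union>(interior ` tiles A)"
      proof
        fix x assume x: "x \<in> - D"
        obtain S where S: "S \<in> tiles A" "x \<in> S"
          using cover by blast
        then obtain V where V: "V \<subseteq> A" "tile_corners V" "S = convex hull V"
          by (auto simp: tiles_iff)
        have "x \<in> interior S"
        proof (rule ccontr)
          assume "x \<notin> interior S"
          then obtain y z where "y \<in> V" "z \<in> V" "dist y z = 2" "x \<in> closed_segment y z"
            using tile_boundary[OF V(2)] S(2) V(3) by blast
          then show False
            using x V(1) unfolding D_def by blast
        qed
        then show "x \<in> \<Union>(interior ` tiles A)"
          using S by blast
      qed
    qed
    show "open X \<and> connected X \<and> X \<noteq> {}" if "X \<in> interior ` tiles A" for X
      using that convex nonempty by (auto simp: convex_connected convex_interior)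
  qed
  moreover have "closure (interior S) = S" if "S \<in> tiles A" for S
    using convex_closure_interior[OF convex nonempty] closed that by simp
  ultimately show ?thesis
    unfolding tiling_of_packing_def \<open>drawn_segments P = D\<close> by (simp add: image_image)
qed

section \<open>Cyclic order around a disc\<close>

lemma inner_Arg2pi: "z \<bullet> w = norm z * norm w * cos (Arg2pi w - Arg2pi z)"
proof -
  have "z \<bullet> w = (norm z * cos (Arg2pi z)) * (norm w * cos (Arg2pi w)) + (norm z * sin (Arg2pi z)) * (norm w * sin (Arg2pi w))"
    by (simp add: inner_complex_def cos_Arg2pi sin_Arg2pi)
  then show ?thesis
    by (simp add: cos_diff algebra_simps)
qed

lemma cross_Arg2pi: "Re z * Im w - Im z * Re w = norm z * norm w * sin (Arg2pi w - Arg2pi z)"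
proof -
  have "Re z * Im w - Im z * Re w =
    (norm z * cos (Arg2pi z)) * (norm w * sin (Arg2pi w)) - (norm z * sin (Arg2pi z)) * (norm w * cos (Arg2pi w))"
    by (simp add: cos_Arg2pi sin_Arg2pi)
  then show ?thesis
    by (simp add: sin_diff algebra_simps)
qed

text \<open>The sign of \<open>Im (w / z)\<close> says that the counterclockwise turn from
  \<open>z\<close> to \<open>w\<close> lies strictly between 0 and pi; it is also the sign of an
  area.\<close>

lemma Im_divide_pos_iff: "0 < Im (w / z) \<longleftrightarrow> 0 < Re z * Im w - Im z * Re w"
proof (cases "z = 0")
  case False
  then have "0 < (Re z)\<^sup>2 + (Im z)\<^sup>2"
    by (simp add: sum_power2_gt_zero_iff complex_eq_iff)
  then show ?thesis
    by (simp add: Im_divide zero_less_divide_iff mult.commute)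
qed simp

lemma angle_at_Arg2pi:
  assumes "a \<noteq> m" "b \<noteq> m"
  shows "angle_at m a b = arccos (cos (Arg2pi (b - m) - Arg2pi (a - m)))"
  using assms by (simp add: angle_at_def inner_Arg2pi)

lemma arccos_cos_le: "0 \<le> x \<Longrightarrow> arccos (cos x) \<le> x"
  using arccos_cos[of x] arccos_ubound[of "cos x"] by (cases "x \<le> pi") auto

text \<open>After division by \<open>v\<close> the generators are 1 and a point \<open>y\<close> of
  the upper half-plane. Cramer's rule gives the coordinates \<open>s\<close>, \<open>t\<close>, and
  their signs are those of sines of turns between 0 and pi.\<close>

lemma cone_of_Arg2pi:
  assumes w: "0 < Im (w / v)" and z: "Arg2pi (z / v) \<le> Arg2pi (w / v)"
  obtains s t where "0 \<le> s" "0 \<le> t" "z = s *\<^sub>R v + t *\<^sub>R w"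
proof -
  have v: "v \<noteq> 0"
    using w by auto
  define x y where "x = z / v" and "y = w / v"
  have y: "0 < Im y"
    using w by (simp add: y_def)
  then have Ay: "0 < Arg2pi y" "Arg2pi y < pi"
    using Arg2pi_lt_pi by blast+
  define s t where "s = (Re x * Im y - Im x * Re y) / Im y" and "t = Im x / Im y"
  have "0 \<le> sin (Arg2pi y - Arg2pi x)"
    using z Ay Arg2pi_ge_0[of x] by (intro sin_ge_zero) (auto simp: x_def y_def)
  then have "0 \<le> s"
    using y by (simp add: s_def cross_Arg2pi)
  moreover have "0 \<le> sin (Arg2pi x)"
    using z Ay Arg2pi_ge_0[of x] by (intro sin_ge_zero) (auto simp: x_def y_def)
  then have "0 \<le> t"
    using y sin_Arg2pi[of x] by (simp add: t_def flip: sin_Arg2pi)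
  moreover have "x = s *\<^sub>R 1 + t *\<^sub>R y"
    using y by (simp add: complex_eq_iff s_def t_def field_simps)
  then have "v * x = v * (s *\<^sub>R 1 + t *\<^sub>R y)"
    by simp
  then have "z = s *\<^sub>R v + t *\<^sub>R w"
    using v by (simp add: x_def y_def distrib_left)
  ultimately show ?thesis
    using that by blast
qed

text \<open>A member of \<open>N\<close> from which the counterclockwise turn to \<open>p\<close> is smallest has its successor beyond
  \<open>p\<close>.\<close>

lemma successor_cone:
  fixes g :: "'a \<Rightarrow> complex"
  assumes N: "finite N" "N \<noteq> {}" and succ: "\<And>e. e \<in> N \<Longrightarrow> \<exists>f\<in>N. R e f \<and> 0 < Im (g f / g e)"
  obtains e f s t where "e \<in> N" "f \<in> N" "R e f" "0 \<le> s" "0 \<le> t" "p = s *\<^sub>R g e + t *\<^sub>R g f"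
proof -
  obtain e where e: "e \<in> N" "\<And>f. f \<in> N \<Longrightarrow> Arg2pi (p / g e) \<le> Arg2pi (p / g f)"
    using ex_is_arg_min_if_finite[OF N, of "\<lambda>e. Arg2pi (p / g e)"]
    by (auto simp: is_arg_min_linorder)
  obtain f where f: "f \<in> N" "R e f" "0 < Im (g f / g e)"
    using succ[OF e(1)] by blast
  \<comment> \<open>If \<open>p\<close> were beyond the successor \<open>f\<close>, the turn from
    \<open>f\<close> to \<open>p\<close> would be smaller by the positive turn from \<open>e\<close>
    to \<open>f\<close>, against the choice of \<open>e\<close>. The point \<open>p = 0\<close> has
    argument 0 and cannot be beyond.\<close>
  have "Arg2pi (p / g e) \<le> Arg2pi (g f / g e)"
  proof (rule ccontr)
    assume less: "\<not> Arg2pi (p / g e) \<le> Arg2pi (g f / g e)"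
    have ne: "g f / g e \<noteq> 0" "g e \<noteq> 0" "g f \<noteq> 0"
      using f(3) by auto
    moreover have "p / g e \<noteq> 0"
      using less Arg2pi_ge_0[of "g f / g e"] by (metis Arg2pi_0)
    ultimately have "Arg2pi ((p / g e) / (g f / g e)) = Arg2pi (p / g e) - Arg2pi (g f / g e)"
      using less by (intro Arg2pi_divide) auto
    moreover have "(p / g e) / (g f / g e) = p / g f"
      using ne by simp
    ultimately have "Arg2pi (p / g f) = Arg2pi (p / g e) - Arg2pi (g f / g e)"
      by metis
    moreover have "0 < Arg2pi (g f / g e)"
      using f(3) Arg2pi_lt_pi by blast
    ultimately show False
      using e(2)[OF f(1)] by linarith
  qed
  then show ?thesis
    using cone_of_Arg2pi[OF f(3)] that e(1) f(1,2) by metis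
qed

section \<open>Angular gaps in a cyclically ordered list\<close>

definition gap :: "(nat \<Rightarrow> real) \<Rightarrow> nat \<Rightarrow> nat \<Rightarrow> real" where
  "gap \<phi> n i = (if Suc i < n then \<phi> (Suc i) - \<phi> i else \<phi> 0 + 2 * pi - \<phi> i)"

lemma sum_gap: "0 < n \<Longrightarrow> (\<Sum>i<n. gap \<phi> n i) = 2 * pi"
proof -
  assume "0 < n"
  then obtain m where m: "n = Suc m"
    using gr0_conv_Suc by blast
  have "(\<Sum>i<m. gap \<phi> n i) = (\<Sum>i<m. \<phi> (Suc i) - \<phi> i)"
    by (rule sum.cong) (auto simp: gap_def m)
  also have "\<dots> = \<phi> m - \<phi> 0"
    by (rule sum_lessThan_telescope)
  finally show ?thesis
    by (simp add: m gap_def)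
qed

abbreviation direction :: "disc \<Rightarrow> disc \<Rightarrow> complex" where
  "direction D E \<equiv> centre E - centre D"

abbreviation next_in :: "disc list \<Rightarrow> nat \<Rightarrow> disc" where
  "next_in Ds i \<equiv> Ds ! (Suc i mod length Ds)"

abbreviation list_gap :: "disc \<Rightarrow> disc list \<Rightarrow> nat \<Rightarrow> real" where
  "list_gap D Ds \<equiv> gap (\<lambda>i. Arg2pi (direction D (Ds ! i))) (length Ds)"

text \<open>At the last index the gap exceeds the difference of arguments by a full turn, which
  cosine and sine do not see.\<close>

lemma list_gap_cos_sin:
  assumes "i < length Ds"
  shows "cos (Arg2pi (direction D (next_in Ds i)) - Arg2pi (direction D (Ds ! i))) = cos (list_gap D Ds i)"
    and "sin (Arg2pi (direction D (next_in Ds i)) - Arg2pi (direction D (Ds ! i))) = sin (list_gap D Ds i)"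
proof -
  consider "Suc i < length Ds" | "Suc i = length Ds"
    using assms by linarith
  then have "cos (Arg2pi (direction D (next_in Ds i)) - Arg2pi (direction D (Ds ! i))) = cos (list_gap D Ds i) \<and>
    sin (Arg2pi (direction D (next_in Ds i)) - Arg2pi (direction D (Ds ! i))) = sin (list_gap D Ds i)"
  proof cases
    case 2
    let ?d = "Arg2pi (direction D (Ds ! 0)) - Arg2pi (direction D (Ds ! i))"
    have "list_gap D Ds i = ?d + 2 * pi"
      using 2 by (simp add: gap_def)
    then show ?thesis
      using 2 by (simp only: mod_self cos_periodic sin_periodic)
  qed (simp add: gap_def)
  then show "cos (Arg2pi (direction D (next_in Ds i)) - Arg2pi (direction D (Ds ! i))) = cos (list_gap D Ds i)"
    "sin (Arg2pi (direction D (next_in Ds i)) - Arg2pi (direction D (Ds ! i))) = sin (list_gap D Ds i)"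
    by blast+
qed

lemma angle_at_list_gap:
  assumes "\<And>E. E \<in> set Ds \<Longrightarrow> centre E \<noteq> centre D" and i: "i < length Ds"
  shows "angle_at (centre D) (centre (Ds ! i)) (centre (next_in Ds i)) = arccos (cos (list_gap D Ds i))"
proof -
  have "Suc i mod length Ds < length Ds"
    using i by (intro mod_less_divisor) linarith
  then have "next_in Ds i \<in> set Ds" "Ds ! i \<in> set Ds"
    using i by (blast intro: nth_mem)+
  then show ?thesis
    using assms(1) angle_at_Arg2pi list_gap_cos_sin(1)[OF i] by metis
qed

lemma list_gap_pos:
  assumes "cyclically_ordered D Ds" "i < length Ds"
  shows "0 < list_gap D Ds i"
proof (cases "Suc i < length Ds")
  case True
  then show ?thesis
    using assms sorted_wrt_nth_less[of _ Ds i "Suc i"] by (simp add: cyclically_ordered_def gap_def)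
next
  case False
  then show ?thesis
    using Arg2pi_lt_2pi[of "direction D (Ds ! i)"] Arg2pi_ge_0[of "direction D (Ds ! 0)"]
    by (simp add: gap_def)
qed

text \<open>An unoriented angle never exceeds the corresponding counterclockwise gap, and both
  families add up to 2 pi. Hence they agree term by term, each gap is below pi, and the step to the
  next disc is a left turn.\<close>

lemma surrounds_successor:
  assumes cyc: "cyclically_ordered D Ds" and sur: "surrounds Ds D"
    and ne: "\<And>E. E \<in> set Ds \<Longrightarrow> centre E \<noteq> centre D" and i: "i < length Ds"
  shows "tangent (Ds ! i) (next_in Ds i)"
    and "0 < Im (direction D (next_in Ds i) / direction D (Ds ! i))"
proof -
  define \<theta> where "\<theta> = (\<lambda>i. angle_at (centre D) (centre (Ds ! i)) (centre (next_in Ds i)))"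
  define n where "n = length Ds"
  have sur': "\<And>i. i < n \<Longrightarrow> tangent (Ds ! i) (next_in Ds i)" "\<And>i. i < n \<Longrightarrow> 0 < \<theta> i \<and> \<theta> i < pi"
    "(\<Sum>i<n. \<theta> i) = 2 * pi"
    using sur by (simp_all add: surrounds_def Let_def \<theta>_def n_def)
  show "tangent (Ds ! i) (next_in Ds i)"
    using sur' i by (simp add: n_def)
  have \<theta>: "\<theta> i = arccos (cos (list_gap D Ds i))" if "i < n" for i
    using angle_at_list_gap[OF ne] that by (simp add: \<theta>_def n_def)
  have le: "\<theta> i \<le> list_gap D Ds i" if "i < n" for i
    using \<theta>[OF that] arccos_cos_le list_gap_pos[OF cyc] that by (simp add: n_def less_imp_le)
  have "0 < n"
    using i unfolding n_def by linarith
  then have "(\<Sum>i<n. list_gap D Ds i - \<theta> i) = 0"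
    using sur'(3) sum_gap[of n] by (simp add: sum_subtractf n_def)
  then have "list_gap D Ds i - \<theta> i = 0"
    using sum_nonneg_eq_0_iff[of "{..<n}" "\<lambda>i. list_gap D Ds i - \<theta> i"] le i by (simp add: n_def)
  then have "0 < list_gap D Ds i" "list_gap D Ds i < pi"
    using sur'(2)[of i] i by (simp_all add: n_def)
  then have "0 < sin (list_gap D Ds i)"
    by (rule sin_gt_zero)
  moreover have "Suc i mod length Ds < length Ds"
    using i by (intro mod_less_divisor) linarith
  then have "next_in Ds i \<in> set Ds" "Ds ! i \<in> set Ds"
    using i by (blast intro: nth_mem)+
  then have "0 < norm (direction D (Ds ! i)) * norm (direction D (next_in Ds i))"
    using ne by simp
  ultimately show "0 < Im (direction D (next_in Ds i) / direction D (Ds ! i))"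
    unfolding Im_divide_pos_iff cross_Arg2pi list_gap_cos_sin(2)[OF i] by (rule mult_pos_pos[rotated])
qed

text \<open>The list is \<open>N\<close> sorted by argument. The clause about \<open>G\<close>
  leaves the closed cone from \<open>E\<close> to \<open>F\<close> free of other members, which
  forces the next entry after \<open>E\<close> to be \<open>F\<close>, so that tangency and the left
  turn pass to consecutive entries.\<close>

lemma surrounds_intro:
  assumes N: "finite N" "N \<noteq> {}"
    and succ: "\<And>E. E \<in> N \<Longrightarrow> \<exists>F\<in>N. tangent E F \<and> 0 < Im (direction D F / direction D E) \<and>
      (\<forall>G\<in>N. \<forall>s\<ge>0. \<forall>t\<ge>0. direction D G = s *\<^sub>R direction D E + t *\<^sub>R direction D F \<longrightarrow> G = E \<or> G = F)"
  obtains Ds where "set Ds = N" "cyclically_ordered D Ds" "surrounds Ds D"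
proof -
  define f where "f = (\<lambda>E. Arg2pi (direction D E))"
  have ne: "direction D E \<noteq> 0" if "E \<in> N" for E
    using succ[OF that] by auto
  have inj: "inj_on f N"
  proof (rule inj_onI)
    fix E G assume EG: "E \<in> N" "G \<in> N" "f E = f G"
    then obtain x where x: "0 < x" "direction D G = of_real x * direction D E"
      using Arg2pi_eq_iff[of "direction D G" "direction D E"] ne by (auto simp: f_def)
    obtain F where F: "0 < Im (direction D F / direction D E)"
      "\<forall>G\<in>N. \<forall>s\<ge>0. \<forall>t\<ge>0. direction D G = s *\<^sub>R direction D E + t *\<^sub>R direction D F \<longrightarrow> G = E \<or> G = F"
      using succ[OF EG(1)] by blast
    \<comment> \<open>Two members in the same direction are excluded by the cone condition with
      coefficient 0 at \<open>F\<close>.\<close>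
    have "direction D G = x *\<^sub>R direction D E + 0 *\<^sub>R direction D F"
      using x(2) by (simp add: scaleR_conv_of_real)
    then have "G = E \<or> G = F"
      using F(2) EG(2) x(1) by (meson less_imp_le order_refl)
    moreover have "G \<noteq> F"
      using F(1) x(2) ne[OF EG(1)] by auto
    ultimately show "E = G"
      by simp
  qed
  obtain ys where ys: "set ys = N" "distinct ys"
    using finite_distinct_list[OF N(1)] by blast
  define Ds where "Ds = sort_key f ys"
  have set: "set Ds = N"
    by (simp add: Ds_def ys)
  have "sorted (map f Ds)" "distinct (map f Ds)"
    using ys inj by (simp_all add: Ds_def distinct_map)
  then have "sorted_wrt (<) (map f Ds)"
    using strict_sorted_iff by blast
  then have cyc: "cyclically_ordered D Ds"
    by (simp add: cyclically_ordered_def sorted_wrt_map f_def)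
  define n where "n = length Ds"
  have less: "f (Ds ! i) < f (Ds ! j)" if "i < j" "j < n" for i j
    using sorted_wrt_nth_less[OF cyc[unfolded cyclically_ordered_def] that(1)] that(2)
    by (simp add: f_def n_def)
  have mem: "Ds ! i \<in> N" if "i < n" for i
    using that set by (auto simp: n_def)
  have ratio: "Arg2pi (direction D (Ds ! j) / direction D (Ds ! i)) =
      (if i \<le> j then f (Ds ! j) - f (Ds ! i) else f (Ds ! j) - f (Ds ! i) + 2 * pi)" if "i < n" "j < n" for i j
    using Arg2pi_diff[OF ne[OF mem[OF that(2)]] ne[OF mem[OF that(1)]]] less[of i j] less[of j i] that
    by (cases i j rule: linorder_cases) (auto simp: f_def)
  have step: "tangent (Ds ! i) (next_in Ds i) \<and> list_gap D Ds i < pi" if i: "i < n" for i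
  proof -
    let ?E = "Ds ! i" and ?G = "next_in Ds i"
    obtain F where F: "F \<in> N" "tangent ?E F" "0 < Im (direction D F / direction D ?E)"
      "\<forall>G\<in>N. \<forall>s\<ge>0. \<forall>t\<ge>0. direction D G = s *\<^sub>R direction D ?E + t *\<^sub>R direction D F \<longrightarrow> G = ?E \<or> G = F"
      using succ[OF mem[OF i]] by blast
    then obtain j where j: "j < n" "F = Ds ! j"
      using set by (metis in_set_conv_nth n_def)
    have "j \<noteq> i"
      using F(3) ne[OF mem[OF i]] j(2) by auto
    have FE: "Arg2pi (direction D F / direction D ?E) < pi"
      using F(3) Arg2pi_lt_pi by blast
    have GE: "Arg2pi (direction D ?G / direction D ?E) = list_gap D Ds i" and Gi: "?G \<noteq> ?E" and G: "?G \<in> N"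
    proof -
      consider "Suc i < n" | "Suc i = n"
        using i by linarith
      then have "Arg2pi (direction D ?G / direction D ?E) = list_gap D Ds i \<and> ?G \<noteq> ?E \<and> ?G \<in> N"
      proof cases
        case 1
        then show ?thesis
          using ratio[OF i 1] less[of i "Suc i"] mem[OF 1] by (auto simp: gap_def n_def f_def)
      next
        case 2
        \<comment> \<open>\<open>F\<close> differs from \<open>E\<close>, so there are at least two
          entries and the wrap-around leads to another disc.\<close>
        then have "0 < i"
          using j \<open>j \<noteq> i\<close> by linarith
        moreover have "0 < n"
          using i by linarith
        ultimately show ?thesis
          using 2 ratio[OF i \<open>0 < n\<close>] less[of 0 i] mem[OF \<open>0 < n\<close>] i
          by (auto simp: gap_def n_def f_def)
      qed
      then show "Arg2pi (direction D ?G / direction D ?E) = list_gap D Ds i" "?G \<noteq> ?E" "?G \<in> N"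
        by blast+
    qed
    \<comment> \<open>The next entry comes no later than \<open>F\<close> in counterclockwise order,
      so it lies in the cone and must be \<open>F\<close>.\<close>
    have "list_gap D Ds i \<le> Arg2pi (direction D F / direction D ?E)"
    proof (cases "i \<le> j")
      case True
      then have "i < j"
        using \<open>j \<noteq> i\<close> by simp
      then have "Suc i < n" "f (Ds ! Suc i) \<le> f (Ds ! j)"
        using j(1) less[of "Suc i" j] by (auto simp: le_less dest!: Suc_leI)
      then show ?thesis
        using ratio[OF i j(1)] True j(2) by (simp add: gap_def n_def f_def)
    next
      case False
      have "f (Ds ! 0) \<le> f (Ds ! j)"
        using j(1) less[of 0 j] by (cases "j = 0") auto
      moreover have "f (Ds ! Suc i) < 2 * pi" "0 \<le> f (Ds ! j)"
        by (simp_all add: f_def Arg2pi_lt_2pi Arg2pi_ge_0)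
      ultimately show ?thesis
        using ratio[OF i j(1)] False j(2) by (simp add: gap_def n_def f_def)
    qed
    then have "?G = F"
      using cone_of_Arg2pi[OF F(3), of "direction D ?G"] GE Gi G F(4) by metis
    then show ?thesis
      using F(2) FE GE by simp
  qed
  have "angle_at (centre D) (centre (Ds ! i)) (centre (next_in Ds i)) = list_gap D Ds i" if "i < n" for i
  proof -
    have "angle_at (centre D) (centre (Ds ! i)) (centre (next_in Ds i)) = arccos (cos (list_gap D Ds i))"
      using that ne set by (intro angle_at_list_gap) (auto simp: n_def)
    also have "\<dots> = list_gap D Ds i"
      using step[OF that] list_gap_pos[OF cyc] that by (intro arccos_cos) (auto simp: n_def less_imp_le)
    finally show ?thesis .
  qed
  moreover have "0 < n"
    using set N(2) by (auto simp: n_def)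
  ultimately have "surrounds Ds D"
    using step list_gap_pos[OF cyc] sum_gap[of n] by (simp add: surrounds_def Let_def n_def)
  then show ?thesis
    using that set cyc by blast
qed

section \<open>From packings to tilings\<close>

text \<open>A point of \<open>A\<close> lies in some tile, and as a singleton cell it can meet that
  tile only if it is one of the corners.\<close>

lemma vertices_tiles:
  assumes A: "separated A" and cover: "\<Union>(tiles A) = UNIV"
  shows "\<Union>(vertices ` tiles A) = A"
proof
  show "\<Union>(vertices ` tiles A) \<subseteq> A"
  proof
    fix x assume "x \<in> \<Union>(vertices ` tiles A)"
    then obtain V where V: "V \<subseteq> A" "tile_corners V" "x \<in> vertices (convex hull V)"
      unfolding tiles_iff by (auto simp: tiles_def)
    then show "x \<in> A"
      using vertices_tile[OF V(2)] by blast
  qed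
  show "A \<subseteq> \<Union>(vertices ` tiles A)"
  proof
    fix x assume x: "x \<in> A"
    obtain S where S: "S \<in> tiles A" "x \<in> S"
      using cover by blast
    then obtain V where V: "V \<subseteq> A" "tile_corners V" "S = convex hull V"
      unfolding tiles_iff by blast
    have "x \<in> convex hull V \<inter> convex hull {x}"
      using S V by simp
    then have "x \<in> V"
      using cell_Int(1)[OF cell_tile[OF A V(1,2)] cell_point[OF x]] by (cases "x \<in> V") auto
    then show "x \<in> \<Union>(vertices ` tiles A)"
      using S V vertices_tile by blast
  qed
qed

definition square_centres :: "complex set \<Rightarrow> complex set" where
  "square_centres A = {b. \<exists>a u v. u \<bullet> u = 4 \<and> v \<bullet> v = 4 \<and> u \<bullet> v = 0 \<and>
     {a, a + u, a + u + v, a + v} \<subseteq> A \<and> b = a + (u + v) /\<^sub>R 2}"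

lemma square_tile_centre:
  "{polygon_centre S | S. S \<in> tiles A \<and> is_square 2 S} = square_centres A" (is "?L = _")
proof
  show "?L \<subseteq> square_centres A"
  proof
    fix b assume "b \<in> ?L"
    then obtain V W where V: "V \<subseteq> A" "tile_corners V" and W: "square_corners W"
      and eq: "convex hull V = convex hull W" and b: "b = polygon_centre (convex hull W)"
      by (auto simp: tiles_iff is_square_2_iff)
    then have "W \<subseteq> A"
      using vertices_tile by metis
    obtain a u v where "u \<bullet> u = 4" "v \<bullet> v = 4" "u \<bullet> v = 0" "W = {a, a + u, a + u + v, a + v}"
      using W by (auto simp: square_corners_def)
    then show "b \<in> square_centres A"
      using \<open>W \<subseteq> A\<close> polygon_centre_square[of u v a] b unfolding square_centres_def by blast
  qed
  show "square_centres A \<subseteq> ?L"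
  proof
    fix b assume "b \<in> square_centres A"
    then obtain a u v where uv: "u \<bullet> u = 4" "v \<bullet> v = 4" "u \<bullet> v = 0"
      and sub: "{a, a + u, a + u + v, a + v} \<subseteq> A" and b: "b = a + (u + v) /\<^sub>R 2"
      by (auto simp: square_centres_def)
    have "square_corners {a, a + u, a + u + v, a + v}"
      using uv by (auto simp: square_corners_def)
    then have "convex hull {a, a + u, a + u + v, a + v} \<in> tiles A"
      "is_square 2 (convex hull {a, a + u, a + u + v, a + v})"
      using sub unfolding tiles_iff is_square_2_iff by blast+
    then show "b \<in> ?L"
      using polygon_centre_square[OF uv, of a] b by force
  qed
qed

lemma packing_of_tiles:
  assumes "separated A" "\<Union>(tiles A) = UNIV"
  shows "packing_of_tiling r (tiles A) = A \<times> {1} \<union> square_centres A \<times> {r}"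
proof -
  have "{(x, 1::real) | x S. S \<in> tiles A \<and> x \<in> vertices S} = \<Union>(vertices ` tiles A) \<times> {1}"
    by auto
  moreover have "{(polygon_centre S, r) | S. S \<in> tiles A \<and> is_square 2 S} =
    {polygon_centre S | S. S \<in> tiles A \<and> is_square 2 S} \<times> {r}"
    by auto
  ultimately show ?thesis
    unfolding packing_of_tiling_def vertices_tiles[OF assms] square_tile_centre by simp
qed

lemma packing_dist:
  assumes "packing P" "D \<in> P" "E \<in> P" "D \<noteq> E"
  shows "radius D + radius E \<le> dist (centre D) (centre E)"
proof -
  have "disjnt (interior (disc_points D)) (interior (disc_points E))" "0 < radius D" "0 < radius E"
    using assms by (auto simp: packing_def pairwise_def)
  then show ?thesis
    by (intro disjoint_balls_dist) (auto simp: disc_points_def disjnt_def)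
qed

text \<open>The form in which compactness is used from here on, except in the angle count around a
  small disc, which needs the whole list.\<close>

lemma compact_packing_successor:
  assumes P: "compact_packing P" and D: "D \<in> P"
  defines "N \<equiv> {E \<in> P. tangent D E}"
  shows "finite N" "N \<noteq> {}"
    and "\<And>E. E \<in> N \<Longrightarrow> \<exists>F\<in>N. tangent E F \<and> 0 < Im (direction D F / direction D E)"
proof -
  obtain Ds where Ds: "set Ds = N" "cyclically_ordered D Ds" "surrounds Ds D"
    using P D by (auto simp: compact_packing_def N_def)
  have "centre E \<noteq> centre D" if "E \<in> N" for E
  proof -
    have "0 < radius D" "0 < radius E"
      using P D that by (auto simp: N_def compact_packing_def packing_def)
    then show ?thesis
      using that by (auto simp: N_def tangent_def)
  qed
  then have succ: "tangent (Ds ! i) (next_in Ds i) \<and>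
    0 < Im (direction D (next_in Ds i) / direction D (Ds ! i))" if "i < length Ds" for i
    using surrounds_successor[OF Ds(2,3)] Ds(1) that by blast
  show "finite N"
    using Ds(1) by (metis List.finite_set)
  show "N \<noteq> {}"
    using Ds(1,3) by (auto simp: surrounds_def)
  show "\<exists>F\<in>N. tangent E F \<and> 0 < Im (direction D F / direction D E)" if E: "E \<in> N" for E
  proof -
    obtain i where i: "i < length Ds" "E = Ds ! i"
      using Ds(1) E by (metis in_set_conv_nth)
    moreover have "Suc i mod length Ds < length Ds"
      using i(1) by (intro mod_less_divisor) linarith
    then have "next_in Ds i \<in> N"
      using Ds(1) by (metis nth_mem)
    ultimately show ?thesis
      using succ by blast
  qed
qed

text \<open>In units of \<open>\<pi> / 6\<close> the equation reads \<open>k + b \<gamma> = 12\<close> with \<open>2.4 < \<gamma> < 2.5\<close>, which has no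
  solution in natural numbers \<open>k\<close>, \<open>b\<close> with \<open>b > 0\<close>.\<close>

lemma angle_sum_excludes:
  fixes \<theta> :: "'i \<Rightarrow> real"
  assumes I: "finite I" and val: "\<And>i. i \<in> I \<Longrightarrow> \<theta> i \<in> {pi / 2, \<alpha>, pi / 3}"
    and sum: "sum \<theta> I = 2 * pi" and \<alpha>: "2 * pi / 5 < \<alpha>" "\<alpha> < 5 * pi / 12" and i: "i \<in> I"
  shows "\<theta> i \<noteq> \<alpha>"
proof
  assume "\<theta> i = \<alpha>"
  define \<gamma> where "\<gamma> = \<alpha> / (pi / 6)"
  have \<gamma>: "12 / 5 < \<gamma>" "\<gamma> < 5 / 2" "\<alpha> = pi / 6 * \<gamma>"
    using \<alpha> by (simp_all add: \<gamma>_def field_simps)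
  define k :: "'i \<Rightarrow> nat" where "k = (\<lambda>i. if \<theta> i = pi / 2 then 3 else if \<theta> i = \<alpha> then 0 else 2)"
  define K where "K = (\<Sum>i\<in>I. k i)"
  define b where "b = card {i \<in> I. \<theta> i = \<alpha>}"
  have "\<alpha> \<noteq> pi / 2"
    using \<alpha> pi_gt_zero by linarith
  then have \<theta>: "\<theta> i = pi / 6 * (real (k i) + (if \<theta> i = \<alpha> then \<gamma> else 0))" if "i \<in> I" for i
  proof (cases "\<theta> i = \<alpha>")
    case True
    then have "k i = 0"
      using \<open>\<alpha> \<noteq> pi / 2\<close> unfolding k_def by metis
    then show ?thesis
      using True \<gamma>(3) by simp
  next
    case False
    then have "\<theta> i = pi / 2 \<and> k i = 3 \<or> \<theta> i = pi / 3 \<and> k i = 2"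
      using val[OF that] unfolding k_def by auto
    then show ?thesis
      using False by auto
  qed
  have "2 * pi = sum \<theta> I"
    by (simp add: sum)
  also have "\<dots> = (\<Sum>i\<in>I. pi / 6 * (real (k i) + (if \<theta> i = \<alpha> then \<gamma> else 0)))"
    by (rule sum.cong[OF refl \<theta>])
  also have "\<dots> = pi / 6 * (real (\<Sum>i\<in>I. k i) + real b * \<gamma>)"
  proof -
    have "(\<Sum>i\<in>I. if \<theta> i = \<alpha> then \<gamma> else 0) = real b * \<gamma>"
      using sum.inter_filter[OF I, of "\<lambda>_. \<gamma>" "\<lambda>i. \<theta> i = \<alpha>"] by (simp add: b_def)
    then show ?thesis
      by (simp only: sum.distrib of_nat_sum flip: sum_distrib_left)
  qed
  finally have "pi * (real K + real b * \<gamma>) = pi * 12"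
    unfolding K_def by linarith
  then have eq: "real K + real b * \<gamma> = 12"
    using mult_left_cancel[OF pi_neq_zero] by blast
  have "0 < b"
    using I i \<open>\<theta> i = \<alpha>\<close> unfolding b_def by (subst card_gt_0_iff) auto
  have "b < 5"
  proof (rule ccontr)
    assume "\<not> b < 5"
    then have "5 * \<gamma> \<le> real b * \<gamma>"
      using \<gamma>(1) by (intro mult_right_mono) auto
    then show False
      using eq \<gamma>(1) of_nat_0_le_iff[of K] by linarith
  qed
  \<comment> \<open>For each \<open>b\<close> the number \<open>12 - b * \<gamma>\<close> falls
    strictly between consecutive integers. The bounds are just sharp enough:
    \<open>5 * \<gamma>\<close> exceeds 12 and \<open>4 * \<gamma>\<close> is below 10.\<close>
  then consider "b = 1" | "b = 2" | "b = 3" | "b = 4"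
    using \<open>0 < b\<close> by linarith
  then show False
  proof cases
    case 1
    then have "9 < real K" "real K < 10"
      using eq \<gamma> by simp_all
    then show ?thesis by simp
  next
    case 2
    then have "7 < real K" "real K < 8"
      using eq \<gamma> by simp_all
    then show ?thesis by simp
  next
    case 3
    then have "4 < real K" "real K < 5"
      using eq \<gamma> by simp_all
    then show ?thesis by simp
  next
    case 4
    then have "2 < real K" "real K < 3"
      using eq \<gamma> by simp_all
    then show ?thesis by simp
  qed
qed

lemma mixed_angle_bounds:
  fixes c :: real
  assumes c: "c = 1 - sqrt 2 / 2"
  shows "2 * pi / 5 < arccos c" "arccos c < 5 * pi / 12"
proof -
  have s2: "sqrt 2 < 283 / 200" "141 / 100 < sqrt 2"
    by (rule real_less_lsqrt real_less_rsqrt; simp add: power2_eq_square)+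
  have s6: "sqrt 6 < 49 / 20"
    by (rule real_less_lsqrt) (simp_all add: power2_eq_square)
  define x where "x = cos (2 * pi / 5)"
  \<comment> \<open>Five times the angle is a full turn, so its double and its triple have equal
    cosines. This gives a cubic for \<open>x\<close>; removing the root 1 leaves the quadratic
    satisfied by \<open>x\<close>.\<close>
  have "cos (2 * (2 * pi / 5)) = cos (3 * (2 * pi / 5))"
  proof -
    have "3 * (2 * pi / 5) = 2 * pi - 2 * (2 * pi / 5)"
      by simp
    then show ?thesis
      by (metis cos_2pi_minus)
  qed
  then have "2 * x\<^sup>2 - 1 = 4 * x ^ 3 - 3 * x"
    unfolding cos_double_cos cos_treble_cos x_def .
  then have "(x - 1) * (4 * x\<^sup>2 + 2 * x - 1) = 0"
    by (simp add: algebra_simps power2_eq_square power3_eq_cube)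
  moreover have "x < cos 0"
    unfolding x_def by (rule cos_monotone_0_pi) (use pi_gt_zero in auto)
  ultimately have q: "4 * x\<^sup>2 + 2 * x = 1"
    by simp
  have "0 < x"
    unfolding x_def by (rule cos_gt_zero) (use pi_gt_zero in auto)
  have "c < x"
  proof (rule ccontr)
    assume "\<not> c < x"
    \<comment> \<open>The threshold 0.3 separates \<open>c\<close>, about 0.293, from the root,
      about 0.309.\<close>
    then have "x < 0.3"
      using c s2 by linarith
    then have "x\<^sup>2 < 0.3\<^sup>2"
      using \<open>0 < x\<close> by (intro power_strict_mono) auto
    then show False
      using q \<open>x < 0.3\<close> by (simp add: power2_eq_square)
  qed
  have c1: "-1 \<le> c" "c \<le> 1"
    using s2 c by linarith+
  have "arccos x = 2 * pi / 5"
    unfolding x_def by (rule arccos_cos) (use pi_gt_zero in auto)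
  moreover have "arccos x < arccos c"
    using \<open>c < x\<close> c1 cos_le_one[of "2 * pi / 5"] by (intro arccos_less_arccos) (auto simp: x_def)
  ultimately show "2 * pi / 5 < arccos c"
    by simp
  have "5 * pi / 12 = pi / 4 + pi / 6"
    by simp
  then have "cos (5 * pi / 12) = sqrt 2 / 2 * (sqrt 3 / 2) - sqrt 2 / 2 * (1 / 2)"
    by (simp only: cos_add cos_45 cos_30 sin_45 sin_30)
  also have "\<dots> = sqrt 6 / 4 - sqrt 2 / 4"
    by (simp flip: real_sqrt_mult)
  finally have "cos (5 * pi / 12) < c"
    using s2 s6 c by linarith
  then have "arccos c < arccos (cos (5 * pi / 12))"
    using c1 by (intro arccos_less_arccos) auto
  also have "arccos (cos (5 * pi / 12)) = 5 * pi / 12"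
    by (rule arccos_cos) (use pi_gt_zero in auto)
  finally show "arccos c < 5 * pi / 12" .
qed

text \<open>The law of cosines, with squared side lengths.\<close>

lemma angle_at_inner:
  assumes "(a - m) \<bullet> (a - m) = p" "(b - m) \<bullet> (b - m) = q" "(a - b) \<bullet> (a - b) = t"
  shows "angle_at m a b = arccos ((p + q - t) / (2 * sqrt (p * q)))"
proof -
  have inner: "(a - m) \<bullet> (b - m) = (p + q - t) / 2"
    using assms by (simp add: inner_diff inner_commute)
  have norm: "norm (a - m) * norm (b - m) = sqrt (p * q)"
    using assms by (simp add: norm_eq_sqrt_inner real_sqrt_mult)
  show ?thesis
    unfolding angle_at_def inner norm by simp
qed

locale small_radius =
  fixes r :: real
  assumes r: "r = sqrt 2 - 1"
begin

lemma r_pos: "0 < r" and r_less: "r < 1 / 2" and r_square: "r\<^sup>2 = 1 - 2 * r" and one_plus_r: "1 + r = sqrt 2"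
proof -
  have "sqrt 2 < 283 / 200" "141 / 100 < sqrt 2"
    by (rule real_less_lsqrt real_less_rsqrt; simp add: power2_eq_square)+
  then show "0 < r" "r < 1 / 2"
    by (simp_all add: r)
  show "r\<^sup>2 = 1 - 2 * r"
    by (simp add: r power2_eq_square algebra_simps)
  show "1 + r = sqrt 2"
    by (simp add: r)
qed

lemma tangent_inner:
  assumes "tangent D E"
  shows "(centre E - centre D) \<bullet> (centre E - centre D) = (radius D + radius E)\<^sup>2"
    and "(centre D - centre E) \<bullet> (centre D - centre E) = (radius D + radius E)\<^sup>2"
  using assms by (simp_all add: tangent_def dist_norm norm_minus_commute flip: power2_norm_eq_inner)

end

locale two_radius_packing = small_radius +
  fixes P :: "disc set"
  assumes P: "compact_packing_using {1, r} P"
begin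

abbreviation large :: "complex set" where "large \<equiv> {x. (x, 1) \<in> P}"

abbreviation small :: "complex set" where "small \<equiv> {x. (x, r) \<in> P}"

lemma compact: "compact_packing P" and radii: "D \<in> P \<Longrightarrow> radius D = 1 \<or> radius D = r"
  and radius_cases: "D \<in> P \<Longrightarrow> (D = (centre D, 1) \<and> centre D \<in> large) \<or> (D = (centre D, r) \<and> centre D \<in> small)"
proof -
  show "compact_packing P"
    using P by (simp add: compact_packing_using_def)
  show rad: "radius D = 1 \<or> radius D = r" if "D \<in> P" for D
    using P that by (auto simp: compact_packing_using_def)
  show "(D = (centre D, 1) \<and> centre D \<in> large) \<or> (D = (centre D, r) \<and> centre D \<in> small)" if "D \<in> P"
    using rad[OF that] that by (cases D) auto
qed

lemma pack: "packing P"
  using compact by (simp add: compact_packing_def)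

lemma separated_large: "separated large"
  unfolding separated_def
proof (intro ballI impI)
  fix x y assume "x \<in> large" "y \<in> large" "x \<noteq> y"
  then show "2 \<le> dist x y"
    using packing_dist[OF pack, of "(x, 1)" "(y, 1)"] by simp
qed

lemma large_nonempty: "large \<noteq> {}" and small_nonempty: "small \<noteq> {}"
proof -
  have "1 \<in> radius ` P" "r \<in> radius ` P"
    using P by (auto simp: compact_packing_using_def)
  then show "large \<noteq> {}" "small \<noteq> {}"
    by force+
qed

text \<open>Two consecutive neighbours subtend pi / 2 if both are large, pi / 3 if both are small,
  and \<open>arccos c\<close> if they differ. The last value cannot occur in a sum of 2 pi, so the
  radius is constant around the list.\<close>

lemma small_neighbours_alike:
  assumes D: "D \<in> P" "radius D = r" and EF: "E \<in> P" "tangent D E" "F \<in> P" "tangent D F"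
  shows "radius E = radius F"
proof -
  obtain Ds where Ds: "set Ds = {E \<in> P. tangent D E}" "surrounds Ds D"
    using compact D(1) by (auto simp: compact_packing_def)
  define n where "n = length Ds"
  define \<theta> where "\<theta> = (\<lambda>i. angle_at (centre D) (centre (Ds ! i)) (centre (next_in Ds i)))"
  define c where "c = 1 - sqrt 2 / 2"
  have sur: "tangent (Ds ! i) (next_in Ds i)" if "i < n" for i
    using Ds(2) that by (simp add: surrounds_def Let_def n_def)
  have sum: "sum \<theta> {..<n} = 2 * pi"
    using Ds(2) by (simp add: surrounds_def Let_def n_def \<theta>_def)
  have nb: "Ds ! i \<in> P" "tangent D (Ds ! i)" if "i < n" for i
    using Ds(1) nth_mem[of i Ds] that by (auto simp: n_def)
  have nxt: "Suc i mod n < n" if "i < n" for i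
    using that by (intro mod_less_divisor) linarith
  have angle: "\<theta> i = (if radius (Ds ! i) = radius (next_in Ds i)
      then (if radius (Ds ! i) = 1 then pi / 2 else pi / 3) else arccos c)" if i: "i < n" for i
  proof -
    have nx: "next_in Ds i \<in> P" "tangent D (next_in Ds i)"
      using nb[OF nxt[OF i]] by (simp_all add: n_def)
    have \<theta>: "\<theta> i = arccos (((r + x)\<^sup>2 + (r + y)\<^sup>2 - (x + y)\<^sup>2) / (2 * sqrt ((r + x)\<^sup>2 * (r + y)\<^sup>2)))"
      if "radius (Ds ! i) = x" "radius (next_in Ds i) = y" for x y
      unfolding \<theta>_def using tangent_inner(1)[OF nb(2)[OF i]] tangent_inner(1)[OF nx(2)]
        tangent_inner(2)[OF sur[OF i]] D(2) that by (intro angle_at_inner) simp_all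
    have sq: "(r + 1)\<^sup>2 = 2" "(1 + r)\<^sup>2 = 2" "(1 + 1)\<^sup>2 = (4 :: real)" "(r + r)\<^sup>2 = 4 * r\<^sup>2"
      using r_square by (simp_all add: power2_eq_square algebra_simps)
    \<comment> \<open>The triangle of centres has squared sides 2 and \<open>4 * r\<^sup>2\<close>
      at the small disc \<open>D\<close>, and 2 opposite to it.\<close>
    have mixed: "(4 * r\<^sup>2) / (2 * sqrt (8 * r\<^sup>2)) = c"
    proof -
      have "sqrt (8 * r\<^sup>2) = 2 * sqrt 2 * r"
        by (rule real_sqrt_unique) (use r_pos in \<open>simp_all add: power_mult_distrib\<close>)
      then have "(4 * r\<^sup>2) / (2 * sqrt (8 * r\<^sup>2)) = r / sqrt 2"
        using r_pos by (simp add: power2_eq_square)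
      moreover have "c * sqrt 2 = r"
        by (simp add: r c_def algebra_simps)
      then have "r / sqrt 2 = c"
        by (simp add: divide_eq_eq)
      ultimately show ?thesis
        by simp
    qed
    have "sqrt (16 * (r\<^sup>2 * r\<^sup>2)) = 4 * r\<^sup>2"
      by (rule real_sqrt_unique) (simp_all add: power2_eq_square)
    then have small: "(4 * r\<^sup>2 + 4 * r\<^sup>2 - 4 * r\<^sup>2) / (2 * sqrt (4 * r\<^sup>2 * (4 * r\<^sup>2))) = 1 / 2"
      using r_pos by simp
    have "arccos (1 / 2) = pi / 3"
      by (rule arccos_unique) (simp_all add: cos_60)
    moreover have "r \<noteq> 1"
      using r_less by simp
    ultimately show ?thesis
      using radii[OF nb(1)[OF i]] radii[OF nx(1)] \<theta>[of 1 1] \<theta>[of 1 r] \<theta>[of r 1] \<theta>[of r r] mixed small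
      by (auto simp: sq)
  qed
  have "\<theta> i \<in> {pi / 2, arccos c, pi / 3}" if "i < n" for i
    unfolding insert_iff using angle[OF that] by metis
  then have "\<theta> i \<noteq> arccos c" if "i < n" for i
    using angle_sum_excludes[of "{..<n}" \<theta> "arccos c", OF _ _ sum mixed_angle_bounds[OF c_def]] that
    by simp
  then have step: "radius (Ds ! i) = radius (next_in Ds i)" if "i < n" for i
    using angle that by metis
  have const: "radius (Ds ! i) = radius (Ds ! 0)" if "i < n" for i
    using that
  proof (induction i)
    case (Suc i)
    then show ?case
      using step[of i] by (simp add: n_def)
  qed simp
  obtain i j where "i < n" "E = Ds ! i" "j < n" "F = Ds ! j"
    using EF Ds(1) by (metis (mono_tags, lifting) in_set_conv_nth mem_Collect_eq n_def)
  then show ?thesis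
    using const by metis
qed

end

lemma quarter_turn:
  assumes "x \<bullet> x = y \<bullet> y" "x \<bullet> y = 0" and pos: "0 < Im (y / x)"
  shows "y = \<i> * x"
proof -
  have "x \<noteq> 0"
    using pos by auto
  define w where "w = y / x"
  have y: "y = w * x"
    using \<open>x \<noteq> 0\<close> by (simp add: w_def)
  have "0 < x \<bullet> x"
    using \<open>x \<noteq> 0\<close> by simp
  have "x \<bullet> y = Re w * (x \<bullet> x)" "y \<bullet> y = ((Re w)\<^sup>2 + (Im w)\<^sup>2) * (x \<bullet> x)"
    by (simp_all add: y inner_complex_def power2_eq_square algebra_simps)
  then have "Re w * (x \<bullet> x) = 0" "((Re w)\<^sup>2 + (Im w)\<^sup>2) * (x \<bullet> x) = 1 * (x \<bullet> x)"
    using assms(1,2) by linarith+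
  then have "Re w = 0" "(Re w)\<^sup>2 + (Im w)\<^sup>2 = 1"
    using \<open>0 < x \<bullet> x\<close> mult_right_cancel[of "x \<bullet> x"] by (metis less_irrefl mult_eq_0_iff)+
  then have "Re w = 0" "(Im w)\<^sup>2 = 1"
    by simp_all
  moreover have "0 < Im w"
    using pos by (simp add: w_def)
  ultimately have "w = \<i>"
    by (auto simp: complex_eq_iff power2_eq_1_iff)
  then show ?thesis
    by (simp add: y)
qed

text \<open>Pairing \<open>p\<close> with its own expansion bounds its length by its pairings with
  the generators. It serves to show that a centre inside a cone would be too close to the
  apex.\<close>

lemma cone_inner_le:
  assumes "p = s *\<^sub>R u + t *\<^sub>R v" "0 \<le> s" "0 \<le> t" "p \<bullet> u \<le> k" "p \<bullet> v \<le> k"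
  shows "p \<bullet> p \<le> k * (s + t)"
proof -
  have "p \<bullet> p = s * (p \<bullet> u) + t * (p \<bullet> v)"
    using arg_cong[OF assms(1), of "(\<bullet>) p"] by (simp add: inner_simps)
  also have "\<dots> \<le> s * k + t * k"
    using assms by (intro add_mono mult_left_mono)
  finally show ?thesis
    by (simp add: algebra_simps)
qed

text \<open>The half-plane of the perpendicular bisector on the side of \<open>y\<close>, written as
  a linear condition on \<open>x - y\<close>.\<close>

lemma nearest_inner_le:
  assumes "dist x y \<le> dist x z"
  shows "2 * ((x - y) \<bullet> (z - y)) \<le> (z - y) \<bullet> (z - y)"
proof -
  have "(x - y) \<bullet> (x - y) \<le> (x - z) \<bullet> (x - z)"
    using assms by (simp add: dist_norm norm_le)
  then show ?thesis
    by (simp add: inner_diff inner_commute algebra_simps)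
qed

lemma triangle_not_square: "triangle_corners V \<Longrightarrow> square_corners W \<Longrightarrow> convex hull V \<noteq> convex hull W"
proof
  assume V: "triangle_corners V" and W: "square_corners W" and "convex hull V = convex hull W"
  then have "V = W"
    using vertices_tile by metis
  obtain a u v where "u \<bullet> u = 4" "v \<bullet> v = 4" "u \<bullet> v = 0" "W = {a, a + u, a + u + v, a + v}"
    using W by (auto simp: square_corners_def)
  moreover from this have "distinct [a, a + u, a + u + v, a + v]"
    by (auto simp: eq_neg_iff_add_eq_0[symmetric] add.assoc)
  ultimately have "card W = 4"
    by simp
  moreover have "card V \<le> 3"
    using V by (auto simp: triangle_corners_def intro!: order_trans[OF card_insert_le_m1])
  ultimately show False
    using \<open>V = W\<close> by simp
qed

lemma tangent_sym: "tangent D E \<longleftrightarrow> tangent E D"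
  by (auto simp: tangent_def dist_commute)

context two_radius_packing
begin

lemma successor:
  assumes "D \<in> P"
  shows "finite {E \<in> P. tangent D E}" "{E \<in> P. tangent D E} \<noteq> {}"
    and "\<And>E. E \<in> P \<Longrightarrow> tangent D E \<Longrightarrow>
      \<exists>F\<in>{E \<in> P. tangent D E}. tangent E F \<and> 0 < Im (direction D F / direction D E)"
  using compact_packing_successor[OF compact assms] by auto

lemma tangent_pair_inner:
  assumes "tangent D E" "tangent D F" "tangent E F"
  shows "2 * (direction D E \<bullet> direction D F) =
    (radius D + radius E)\<^sup>2 + (radius D + radius F)\<^sup>2 - (radius E + radius F)\<^sup>2"
  using tangent_inner(1)[OF assms(1)] tangent_inner(1)[OF assms(2)] tangent_inner(1)[OF assms(3)]
  by (simp add: inner_diff inner_commute)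

text \<open>If a small disc touched only small discs, so would its neighbours; of all such discs take the one
  nearest to a given large disc.  Of two consecutive neighbours towards the large disc, one is
  nearer still.\<close>

lemma small_neighbours_large:
  assumes "b \<in> small" "E \<in> P" "tangent (b, r) E"
  shows "radius E = 1"
proof (rule ccontr)
  assume "radius E \<noteq> 1"
  define H where "H = {h \<in> small. \<exists>E\<in>P. tangent (h, r) E \<and> radius E = r}"
  have "radius E = r"
    using radii[OF assms(2)] \<open>radius E \<noteq> 1\<close> by blast
  then have "b \<in> H"
    using assms unfolding H_def by blast
  then have "H \<noteq> {}"
    by blast
  moreover have "closed H"
  \<comment> \<open>Small centres are at least \<open>2 * r\<close> apart, so \<open>H\<close> is
    closed and has a point nearest to \<open>a\<close>.\<close>
  proof (rule discrete_imp_closed[of "2 * r"])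
    show "\<forall>x\<in>H. \<forall>y\<in>H. dist y x < 2 * r \<longrightarrow> y = x"
      using packing_dist[OF pack] unfolding H_def by fastforce
  qed (use r_pos in simp)
  moreover obtain a where a: "a \<in> large"
    using large_nonempty by blast
  ultimately obtain h where h: "h \<in> H" and nearest: "\<And>x. x \<in> H \<Longrightarrow> dist a h \<le> dist a x"
    using distance_attains_inf by metis
  have hP: "(h, r) \<in> P"
    using h by (simp add: H_def)
  have r_nb: "radius F = r" if "F \<in> P" "tangent (h, r) F" for F
    using h small_neighbours_alike[OF hP _ _ _ that] by (auto simp: H_def)
  obtain E F s t where EF: "E \<in> {E \<in> P. tangent (h, r) E}" "F \<in> {E \<in> P. tangent (h, r) E}" "tangent E F"
    and st: "0 \<le> s" "0 \<le> t" and p: "a - h = s *\<^sub>R direction (h, r) E + t *\<^sub>R direction (h, r) F"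
    using successor_cone[OF successor(1,2)[OF hP], of tangent "direction (h, r)" "a - h"] successor(3)[OF hP]
    by blast
  have in_H: "centre G \<in> H" if "G \<in> P" "tangent (h, r) G" for G
  proof -
    have "G = (centre G, r)"
      using r_nb[OF that] by (metis prod.collapse)
    then show ?thesis
      using that hP unfolding H_def by (metis (mono_tags, lifting) mem_Collect_eq snd_conv tangent_sym)
  qed
  define e f where "e = direction (h, r) E" and "f = direction (h, r) F"
  have rad: "radius E = r" "radius F = r"
    using EF r_nb by auto
  have ee: "e \<bullet> e = 4 * r\<^sup>2" "f \<bullet> f = 4 * r\<^sup>2"
    using tangent_inner(1)[of "(h, r)" E] tangent_inner(1)[of "(h, r)" F] EF rad
    by (simp_all add: e_def f_def flip: power_mult_distrib[of 2 r 2, simplified])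
  have ef: "e \<bullet> f = 2 * r\<^sup>2"
    using tangent_pair_inner[of "(h, r)" E F] EF rad by (simp add: e_def f_def power2_eq_square algebra_simps)
  \<comment> \<open>Since neither neighbour is nearer to \<open>a\<close> than \<open>h\<close>, the
    point \<open>a\<close> falls into the triangle of the three small centres, at squared distance
    at most \<open>2 * r\<^sup>2\<close> from \<open>h\<close>. Disjointness of the large disc and
    the small one demands at least 2.\<close>
  have le: "(a - h) \<bullet> e \<le> 2 * r\<^sup>2" "(a - h) \<bullet> f \<le> 2 * r\<^sup>2"
    using nearest_inner_le[OF nearest[OF in_H[of E]]] nearest_inner_le[OF nearest[OF in_H[of F]]] EF ee
    by (simp_all add: e_def f_def)
  have "(a - h) \<bullet> e = r\<^sup>2 * (4 * s + 2 * t)" "(a - h) \<bullet> f = r\<^sup>2 * (2 * s + 4 * t)"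
    using ee ef unfolding p[folded e_def f_def]
    by (simp_all add: inner_add_left inner_commute[of f e] algebra_simps)
  then have "r\<^sup>2 * (4 * s + 2 * t) \<le> r\<^sup>2 * 2" "r\<^sup>2 * (2 * s + 4 * t) \<le> r\<^sup>2 * 2"
    using le by simp_all
  then have "4 * s + 2 * t \<le> 2" "2 * s + 4 * t \<le> 2"
    using r_pos by simp_all
  then have "s + t \<le> 1"
    by simp
  have "(a - h) \<bullet> (a - h) \<le> 2 * r\<^sup>2 * (s + t)"
    using cone_inner_le[OF p[folded e_def f_def] st le] .
  also have "\<dots> \<le> 2 * r\<^sup>2"
    using \<open>s + t \<le> 1\<close> by (intro mult_left_le) auto
  also have "\<dots> < 2"
    using r_square r_pos by simp
  finally have "(a - h) \<bullet> (a - h) < 2" .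
  moreover have "sqrt 2 \<le> norm (a - h)"
    using packing_dist[OF pack, of "(a, 1)" "(h, r)"] a hP r_less one_plus_r by (simp add: dist_norm)
  ultimately show False
    by (simp add: norm_eq_sqrt_inner)
qed

text \<open>The successor of a large neighbour of a small disc is large again, and the angle between
  them is a right one. Three quarter turns about \<open>b\<close>, starting at \<open>a\<close>,
  thus produce the other corners.\<close>

lemma small_square:
  assumes b: "b \<in> small" and a: "a \<in> large" and tan: "tangent (b, r) (a, 1)"
  obtains u v where "u \<bullet> u = 4" "v \<bullet> v = 4" "u \<bullet> v = 0" "{a, a + u, a + u + v, a + v} \<subseteq> large"
    "b = a + (u + v) /\<^sub>R 2"
proof -
  have sq: "(r + 1)\<^sup>2 = 2"
    using r_square by (simp add: power2_eq_square algebra_simps)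
  have turn: "b + \<i> * x \<in> large \<and> (\<i> * x) \<bullet> (\<i> * x) = 2" if x: "b + x \<in> large" "x \<bullet> x = 2" for x
  proof -
    have "norm x = sqrt 2"
      using x by (simp add: norm_eq_sqrt2_iff)
    then have tx: "tangent (b, r) (b + x, 1)"
      using one_plus_r by (simp add: tangent_def dist_norm add.commute)
    then obtain F where F: "F \<in> P" "tangent (b, r) F" "tangent (b + x, 1) F"
      "0 < Im (direction (b, r) F / direction (b, r) (b + x, 1))"
      using successor(3)[of "(b, r)" "(b + x, 1)"] x b by auto
    have rF: "radius F = 1"
      using small_neighbours_large[OF b F(1,2)] .
    define y where "y = centre F - b"
    have "y \<bullet> y = 2"
      using tangent_inner(1)[OF F(2)] rF sq by (simp add: y_def)
    moreover have "x \<bullet> y = 0"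
      using tangent_pair_inner[OF tx F(2,3)] rF sq by (simp add: y_def)
    ultimately have "y = \<i> * x"
      using F(4) x by (intro quarter_turn) (simp_all add: y_def)
    moreover have "F = (b + y, 1)"
      using rF by (simp add: y_def prod_eq_iff)
    ultimately show ?thesis
      using F(1) \<open>y \<bullet> y = 2\<close> by simp
  qed
  define e where "e = a - b"
  have e: "b + e \<in> large" "e \<bullet> e = 2"
    using tangent_inner(1)[OF tan] sq a by (simp_all add: e_def)
  have e1: "b + \<i> * e \<in> large" "(\<i> * e) \<bullet> (\<i> * e) = 2"
    using turn[OF e] by blast+
  have e2: "b + \<i> * (\<i> * e) \<in> large" "(\<i> * (\<i> * e)) \<bullet> (\<i> * (\<i> * e)) = 2"
    using turn[OF e1] by blast+
  have e3: "b + \<i> * (\<i> * (\<i> * e)) \<in> large"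
    using turn[OF e2] by blast
  have turns: "\<i> * (\<i> * e) = - e" "\<i> * (\<i> * (\<i> * e)) = - (\<i> * e)"
    by (simp_all flip: mult.assoc)
  show ?thesis
  proof (rule that[of "\<i> * e - e" "- e - \<i> * e"])
    show "(\<i> * e - e) \<bullet> (\<i> * e - e) = 4" "(- e - \<i> * e) \<bullet> (- e - \<i> * e) = 4" "(\<i> * e - e) \<bullet> (- e - \<i> * e) = 0"
      using e(2) by (simp_all add: inner_complex_def power2_eq_square algebra_simps)
    have "a = b + e"
      by (simp add: e_def)
    then show "{a, a + (\<i> * e - e), a + (\<i> * e - e) + (- e - \<i> * e), a + (- e - \<i> * e)} \<subseteq> large"
      using a e1(1) e2(1) e3 unfolding turns by (simp add: algebra_simps)
    show "b = a + (\<i> * e - e + (- e - \<i> * e)) /\<^sub>R 2"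
      unfolding \<open>a = b + e\<close> by (simp add: complex_eq_iff)
  qed
qed

definition packing_tiles :: "complex set set" where
  "packing_tiles = {S \<in> tiles large. (\<exists>V. triangle_corners V \<and> S = convex hull V) \<or> polygon_centre S \<in> small}"

text \<open>The small disc at \<open>z\<close> sits in a square with corner \<open>a\<close>; as
  \<open>y\<close> has distance sqrt 2 from \<open>z\<close>, it is a corner too. So the triangle
  \<open>a\<close>, \<open>y\<close>, \<open>z\<close> is a quarter of the square.\<close>

lemma mixed_cone_covered:
  assumes a: "a \<in> large" and y: "y \<in> large" and z: "z \<in> small"
    and tan: "tangent (a, 1) (y, 1)" "tangent (a, 1) (z, r)" "tangent (y, 1) (z, r)"
    and st: "0 \<le> s" "0 \<le> t" and p: "p - a = s *\<^sub>R (y - a) + t *\<^sub>R (z - a)" and nearest: "dist p a \<le> dist p y"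
  shows "\<exists>S\<in>packing_tiles. p \<in> S"
proof -
  have sq: "(1 + r)\<^sup>2 = 2"
    using r_square by (simp add: power2_eq_square algebra_simps)
  obtain u v where uv: "u \<bullet> u = 4" "v \<bullet> v = 4" "u \<bullet> v = 0"
    and V: "{a, a + u, a + u + v, a + v} \<subseteq> large" and zeq: "z = a + (u + v) /\<^sub>R 2"
    using small_square[OF z a] tan(2) tangent_sym by metis
  define S where "S = convex hull {a, a + u, a + u + v, a + v}"
  have "square_corners {a, a + u, a + u + v, a + v}"
    using uv by (auto simp: square_corners_def)
  then have "S \<in> tiles large"
    using V unfolding tiles_iff S_def by blast
  moreover have "polygon_centre S = z"
    using polygon_centre_square[OF uv] zeq by (simp add: S_def)
  ultimately have "S \<in> packing_tiles"
    using z by (simp add: packing_tiles_def)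
  have "(y - z) \<bullet> (y - z) = 2"
    using tangent_inner(2)[OF tan(3)] sq by simp
  then have "y \<in> {a, a + u, a + u + v, a + v}"
    using square_circumcircle(2)[OF separated_large V uv zeq y] by blast
  then have "y \<in> S" "a \<in> S"
    unfolding S_def by (auto intro: hull_inc)
  have "z \<in> S"
    using ball_subset_square[OF uv, of a] zeq by (auto simp: S_def)
  have ya: "(y - a) \<bullet> (y - a) = 4" "2 * ((y - a) \<bullet> (z - a)) = 4"
    using tangent_inner(1)[OF tan(1)] tangent_pair_inner[OF tan] sq by simp_all
  have "(p - a) \<bullet> (y - a) = 4 * s + 2 * t"
    using ya unfolding p by (simp add: inner_add_left inner_commute[of "z - a" "y - a"])
  \<comment> \<open>The bisector of \<open>a\<close> and \<open>y\<close> passes through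
    \<open>z\<close> and gives the stronger bound \<open>2 * s + t \<le> 1\<close>.\<close>
  then have "s + t \<le> 1"
    using nearest_inner_le[OF nearest] ya st by simp
  moreover have "p = (1 - (s + t)) *\<^sub>R a + s *\<^sub>R y + t *\<^sub>R z"
    using p by (simp add: algebra_simps)
  ultimately have "p \<in> convex hull {a, y, z}"
    using st unfolding convex_hull_3
    by (intro CollectI exI[of _ "1 - (s + t)"] exI[of _ s] exI[of _ t]) simp
  moreover have "convex hull {a, y, z} \<subseteq> S"
    using \<open>y \<in> S\<close> \<open>a \<in> S\<close> \<open>z \<in> S\<close> by (intro hull_minimal) (auto simp: S_def)
  ultimately have "p \<in> S"
    by blast
  then show ?thesis
    using \<open>S \<in> packing_tiles\<close> by blast
qed

lemma packing_tiles_cover: "\<Union>packing_tiles = UNIV"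
proof -
  have "\<exists>S\<in>packing_tiles. p \<in> S" for p
  proof -
    have "closed large"
      using separated_large unfolding separated_def
      by (intro discrete_imp_closed[of 2]) (force simp: not_le[symmetric])+
    then obtain a where a: "a \<in> large" and nearest: "\<And>x. x \<in> large \<Longrightarrow> dist p a \<le> dist p x"
      using distance_attains_inf large_nonempty by metis
    then have aP: "(a, 1) \<in> P"
      by simp
    obtain E F s t where EF: "E \<in> {E \<in> P. tangent (a, 1) E}" "F \<in> {E \<in> P. tangent (a, 1) E}" "tangent E F"
      and st: "0 \<le> s" "0 \<le> t" and p: "p - a = s *\<^sub>R direction (a, 1) E + t *\<^sub>R direction (a, 1) F"
      using successor_cone[OF successor(1,2)[OF aP], of tangent "direction (a, 1)" "p - a"] successor(3)[OF aP]
      by blast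
    obtain y z where y: "y = centre E" and z: "z = centre F"
      by blast
    consider "E = (y, 1)" "y \<in> large" "F = (z, 1)" "z \<in> large" | "E = (y, 1)" "y \<in> large" "F = (z, r)" "z \<in> small"
      | "E = (y, r)" "y \<in> small" "F = (z, 1)" "z \<in> large" | "E = (y, r)" "y \<in> small" "F = (z, r)" "z \<in> small"
      using radius_cases[of E] radius_cases[of F] EF y z by blast
    then show ?thesis
    proof cases
      case 1
      have u: "(y - a) \<bullet> (y - a) = 4" "(z - a) \<bullet> (z - a) = 4" "(y - a) \<bullet> (z - a) = 2"
        using tangent_inner(1)[of "(a, 1)" E] tangent_inner(1)[of "(a, 1)" F] tangent_pair_inner[of "(a, 1)" E F] EF 1
        by simp_all
      have "{a, a + (y - a), a + (z - a)} \<subseteq> large"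
        using a 1 by simp
      moreover have "triangle_corners {a, a + (y - a), a + (z - a)}"
        using u unfolding triangle_corners_def by blast
      ultimately have "convex hull {a, a + (y - a), a + (z - a)} \<in> packing_tiles"
        unfolding packing_tiles_def tiles_iff by blast
      moreover have "(p - a) \<bullet> (y - a) = 4 * s + 2 * t" "(p - a) \<bullet> (z - a) = 2 * s + 4 * t"
        using u unfolding p 1 by (simp_all add: inner_add_left inner_commute[of "z - a" "y - a"])
      then have "s + t \<le> 1"
        using nearest_inner_le[OF nearest[OF 1(2)]] nearest_inner_le[OF nearest[OF 1(4)]] u by simp
      then have "p \<in> convex hull {a, a + (y - a), a + (z - a)}"
        using p st 1 unfolding convex_hull_triangle
        by (intro CollectI exI[of _ s] exI[of _ t]) (simp add: algebra_simps)
      ultimately show ?thesis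
        by blast
    next
      case 2
      then show ?thesis
        using mixed_cone_covered[OF a 2(2,4) _ _ _ st _ nearest] EF p by simp
    next
      case 3
      then show ?thesis
        using mixed_cone_covered[OF a 3(4,2) _ _ _ st(2,1) _ nearest] EF p tangent_sym
        by (simp add: add.commute)
    next
      case 4
      then show ?thesis
        using small_neighbours_large[OF 4(2), of F] EF r_less by simp
    qed
  qed
  then show ?thesis
    by blast
qed

lemma packing_tiles_eq: "packing_tiles = tiles large"
  using subset_tiles_eq[OF separated_large _ packing_tiles_cover] by (auto simp: packing_tiles_def)

lemma tiles_cover: "\<Union>(tiles large) = UNIV"
  using packing_tiles_cover packing_tiles_eq by simp

text \<open>A small disc touches some large one and hence is the centre of a square. Conversely a
  square on the large centres is among \<open>packing_tiles\<close>; not being a triangle, it has a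
  small disc at its centre.\<close>

lemma small_eq: "small = square_centres large"
proof
  show "small \<subseteq> square_centres large"
  proof
    fix b assume b: "b \<in> small"
    then obtain E where E: "E \<in> P" "tangent (b, r) E"
      using successor(2)[of "(b, r)"] by auto
    then have "E = (centre E, 1)"
      using small_neighbours_large[OF b] by (metis prod.collapse)
    then have "centre E \<in> large" "tangent (b, r) (centre E, 1)"
      using E by (metis mem_Collect_eq)+
    then show "b \<in> square_centres large"
      using small_square[OF b, of "centre E"] unfolding square_centres_def by blast
  qed
  show "square_centres large \<subseteq> small"
  proof
    fix b assume "b \<in> square_centres large"
    then obtain S where S: "S \<in> tiles large" "is_square 2 S" "b = polygon_centre S"
      unfolding square_tile_centre[symmetric] by blast
    then have "S \<in> packing_tiles"
      by (simp add: packing_tiles_eq)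
    then show "b \<in> small"
      using S(2,3) triangle_not_square unfolding packing_tiles_def is_square_2_iff by blast
  qed
qed

lemma packing_eq: "P = packing_of_tiling r (tiles large)"
proof -
  have "P = large \<times> {1} \<union> small \<times> {r}"
    using radius_cases by fastforce
  then show ?thesis
    unfolding packing_of_tiles[OF separated_large tiles_cover] small_eq[symmetric] .
qed

lemma square_tile: "\<exists>S\<in>tiles large. is_square 2 S"
  using small_nonempty unfolding small_eq square_tile_centre[symmetric] by blast

end

section \<open>From tilings to packings\<close>

text \<open>The oriented area of the parallelogram, with the same sign as \<open>Im (w / z)\<close>
  but bilinear, hence convenient for sums of side vectors.\<close>

definition cross :: "complex \<Rightarrow> complex \<Rightarrow> real" where
  "cross z w = Re z * Im w - Im z * Re w"

lemma Im_divide_pos_cross: "0 < Im (w / z) \<longleftrightarrow> 0 < cross z w"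
  by (simp add: Im_divide_pos_iff cross_def)

lemma cross_simps:
  "cross (x + y) z = cross x z + cross y z" "cross z (x + y) = cross z x + cross z y"
  "cross (x - y) z = cross x z - cross y z" "cross z (x - y) = cross z x - cross z y"
  "cross (s *\<^sub>R x) z = s * cross x z" "cross z (s *\<^sub>R x) = s * cross z x"
  "cross (- x) z = - cross x z" "cross z (- x) = - cross z x"
  "cross x x = 0"
  by (simp_all add: cross_def algebra_simps)

lemma cross_commute: "cross w z = - cross z w"
  by (simp add: cross_def algebra_simps)

lemma cross_ii: "cross z (\<i> * z) = z \<bullet> z"
  by (simp add: cross_def inner_complex_def)

lemma square_cross_nonzero:
  assumes "u \<bullet> u = 4" "v \<bullet> v = 4" "u \<bullet> v = 0"
  shows "cross u v \<noteq> 0"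
proof -
  have "(cross u v)\<^sup>2 + (u \<bullet> v)\<^sup>2 = (u \<bullet> u) * (v \<bullet> v)"
    by (simp add: cross_def inner_complex_def power2_eq_square algebra_simps)
  then show ?thesis
    using assms by auto
qed

text \<open>Distance sqrt 2 from the centre makes \<open>x\<close> a corner, from which the square
  can be described anew; exchanging the two sides, if necessary, makes the description
  counterclockwise.\<close>

lemma square_centre_corner:
  assumes A: "separated A" and b: "b \<in> square_centres A" and x: "x \<in> A" "(x - b) \<bullet> (x - b) = 2"
  obtains u v where "u \<bullet> u = 4" "v \<bullet> v = 4" "u \<bullet> v = 0" "{x, x + u, x + u + v, x + v} \<subseteq> A"
    "b = x + (u + v) /\<^sub>R 2" "0 < cross u v"
proof -
  obtain a u v where uv: "u \<bullet> u = 4" "v \<bullet> v = 4" "u \<bullet> v = 0"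
    and V: "{a, a + u, a + u + v, a + v} \<subseteq> A" and beq: "b = a + (u + v) /\<^sub>R 2"
    using b by (auto simp: square_centres_def)
  have "x \<in> {a, a + u, a + u + v, a + v}"
    using square_circumcircle(2)[OF A V uv beq x(1)] x(2) by blast
  moreover have "square_corners {a, a + u, a + u + v, a + v}"
    using uv by (auto simp: square_corners_def)
  ultimately obtain u' v' where uv': "u' \<bullet> u' = 4" "v' \<bullet> v' = 4" "u' \<bullet> v' = 0"
    and eq: "{a, a + u, a + u + v, a + v} = {x, x + u', x + u' + v', x + v'}"
    by (metis square_corner)
  \<comment> \<open>The centre depends only on the set of corners, not on the chosen
    description.\<close>
  have b': "b = x + (u' + v') /\<^sub>R 2"
    using polygon_centre_square[OF uv, of a] polygon_centre_square[OF uv', of x] beq eq by simp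
  show ?thesis
  proof (cases "0 < cross u' v'")
    case True
    then show ?thesis
      using that[OF uv'] V eq b' by simp
  next
    case False
    then have "0 < cross v' u'"
      using square_cross_nonzero[OF uv'] cross_commute[of v' u'] by linarith
    moreover have "{x, x + v', x + v' + u', x + u'} \<subseteq> A"
      using V unfolding eq by (simp add: add_ac)
    ultimately show ?thesis
      using that[OF uv'(2,1)] uv'(3) b' by (simp add: inner_commute add.commute)
  qed
qed

text \<open>Different squares have disjoint interiors, and each contains its inscribed open disc of
  radius 1.\<close>

lemma square_centres_spread:
  assumes A: "separated A" and b: "b \<in> square_centres A" "c \<in> square_centres A" "b \<noteq> c"
  shows "2 \<le> dist b c"
proof -
  have "\<exists>S\<in>tiles A. ball b 1 \<subseteq> interior S \<and> b = polygon_centre S" if b: "b \<in> square_centres A" for b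
  proof -
    obtain a u v where uv: "u \<bullet> u = 4" "v \<bullet> v = 4" "u \<bullet> v = 0"
      and V: "{a, a + u, a + u + v, a + v} \<subseteq> A" and beq: "b = a + (u + v) /\<^sub>R 2"
      using b by (auto simp: square_centres_def)
    have "square_corners {a, a + u, a + u + v, a + v}"
      using uv by (auto simp: square_corners_def)
    then have "convex hull {a, a + u, a + u + v, a + v} \<in> tiles A"
      using V unfolding tiles_iff by blast
    moreover have "ball b 1 \<subseteq> interior (convex hull {a, a + u, a + u + v, a + v})"
      using ball_subset_square[OF uv, of a] beq by (simp add: interior_maximal)
    ultimately show ?thesis
      using polygon_centre_square[OF uv, of a] beq by metis
  qed
  then obtain S S' where S: "S \<in> tiles A" "ball b 1 \<subseteq> interior S" "b = polygon_centre S"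
    and S': "S' \<in> tiles A" "ball c 1 \<subseteq> interior S'" "c = polygon_centre S'"
    using b by meson
  have "S \<noteq> S'"
    using S(3) S'(3) b(3) by blast
  then have "interior S \<inter> interior S' = {}"
    using tiles_eqI[OF A S(1) S'(1)] interior_subset by blast
  then have "ball b 1 \<inter> ball c 1 = {}"
    using S(2) S'(2) by blast
  then show ?thesis
    using disjoint_balls_dist[of b 1 c 1] by simp
qed

section \<open>The discs on a covering by tiles and the successors of their neighbours\<close>

locale good_tiles = small_radius +
  fixes A :: "complex set"
  assumes sep: "separated A" and cover: "\<Union>(tiles A) = UNIV" and squares: "square_centres A \<noteq> {}"
begin

definition discs :: "disc set" where
  "discs = A \<times> {1} \<union> square_centres A \<times> {r}"

lemma disc_cases:
  assumes "D \<in> discs"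
  obtains x where "D = (x, 1)" "x \<in> A" | b where "D = (b, r)" "b \<in> square_centres A"
  using assms by (auto simp: discs_def)

lemma large_small_inner: "x \<in> A \<Longrightarrow> b \<in> square_centres A \<Longrightarrow> 2 \<le> (x - b) \<bullet> (x - b)"
  unfolding square_centres_def using square_circumcircle(1)[OF sep] by blast

lemma large_small_dist:
  assumes "x \<in> A" "b \<in> square_centres A"
  shows "1 + r \<le> dist x b"
  using large_small_inner[OF assms] by (simp add: one_plus_r dist_norm norm_eq_sqrt_inner)

lemma discs_dist:
  assumes "D \<in> discs" "E \<in> discs" "D \<noteq> E"
  shows "radius D + radius E \<le> dist (centre D) (centre E)"
  using assms(1)
proof (cases rule: disc_cases)
  case D: (1 x)
  from assms(2) show ?thesis
  proof (cases rule: disc_cases)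
    case (1 y)
    then show ?thesis
      using D sep assms(3) by (auto simp: separated_def)
  next
    case (2 b)
    then show ?thesis
      using D large_small_dist by simp
  qed
next
  case D: (2 b)
  from assms(2) show ?thesis
  proof (cases rule: disc_cases)
    case (1 y)
    then show ?thesis
      using D large_small_dist[of y b] by (simp add: dist_commute add.commute)
  next
    case (2 c)
    then show ?thesis
      using D square_centres_spread[OF sep, of b c] assms(3) r_less by auto
  qed
qed

lemma packing_discs: "packing discs"
proof -
  have "disjnt (interior (disc_points D)) (interior (disc_points E))"
    if "D \<in> discs" "E \<in> discs" "D \<noteq> E" for D E
    using disjoint_ballI[OF discs_dist[OF that]] by (simp add: disc_points_def disjnt_def)
  moreover have "0 < radius D" if "D \<in> discs" for D
    using that r_pos by (auto simp: discs_def)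
  ultimately show ?thesis
    by (simp add: packing_def pairwise_def)
qed

lemma tangent_large_large: "tangent (x, 1) (y, 1) \<longleftrightarrow> (y - x) \<bullet> (y - x) = 4"
  by (simp add: tangent_def dist_norm norm_minus_commute flip: norm_eq_2_iff)

lemma tangent_large_small: "tangent (x, 1) (b, r) \<longleftrightarrow> (b - x) \<bullet> (b - x) = 2"
  by (simp add: tangent_def dist_norm norm_minus_commute one_plus_r flip: norm_eq_sqrt2_iff)

lemma tangent_small_large: "tangent (b, r) (x, 1) \<longleftrightarrow> (x - b) \<bullet> (x - b) = 2"
  by (simp add: tangent_def dist_norm norm_minus_commute one_plus_r add.commute flip: norm_eq_sqrt2_iff)

lemma finite_neighbours: "finite {E \<in> discs. tangent D E}"
proof -
  define R where "R = radius D + 1"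
  have "finite (A \<inter> cball (centre D) R)"
    using sep by (intro finite_bounded_if_spread[of _ 2]) (auto simp: separated_def bounded_Int)
  moreover have "finite (square_centres A \<inter> cball (centre D) R)"
    using square_centres_spread[OF sep] by (intro finite_bounded_if_spread[of _ 2]) (auto simp: bounded_Int)
  moreover have "{E \<in> discs. tangent D E} \<subseteq>
    (A \<inter> cball (centre D) R) \<times> {1} \<union> (square_centres A \<inter> cball (centre D) R) \<times> {r}"
    using r_less by (auto simp: discs_def tangent_def R_def)
  ultimately show ?thesis
    by (meson finite.emptyI finite.insertI finite_SigmaI finite_UnI finite_subset)
qed

text \<open>The law of cosines turns disjointness of two neighbours of a large disc into an upper
  bound on the inner product of their directions.\<close>

lemma neighbours_inner_le:
  assumes "E \<in> discs" "G \<in> discs" "E \<noteq> G" "tangent (a, 1) E" "tangent (a, 1) G"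
  shows "direction (a, 1) G \<bullet> direction (a, 1) E \<le> 1 + radius E + radius G - radius E * radius G"
proof -
  have "0 < radius E" "0 < radius G"
    using packing_discs assms by (auto simp: packing_def)
  then have "(radius E + radius G)\<^sup>2 \<le> (dist (centre E) (centre G))\<^sup>2"
    using discs_dist[OF assms(1-3)] by (intro power_mono) auto
  then have "(radius E + radius G)\<^sup>2 \<le> (centre E - centre G) \<bullet> (centre E - centre G)"
    by (simp add: dist_norm power2_norm_eq_inner)
  then show ?thesis
    using tangent_inner(1)[OF assms(4)] tangent_inner(1)[OF assms(5)]
    by (simp add: inner_diff inner_commute power2_eq_square algebra_simps)
qed

text \<open>A third neighbour \<open>G\<close> in the cone must keep away from both \<open>E\<close>
  and \<open>F\<close>, which bounds its pairings with both directions. Then its own direction would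
  be shorter than tangency to the central disc allows.\<close>

lemma no_neighbour_between:
  assumes E: "E \<in> discs" "tangent (a, 1) E" "radius E = 1"
    and F: "F \<in> discs" "tangent (a, 1) F" "tangent E F"
    and G: "G \<in> discs" "tangent (a, 1) G"
    and st: "0 \<le> s" "0 \<le> t" and g: "direction (a, 1) G = s *\<^sub>R direction (a, 1) E + t *\<^sub>R direction (a, 1) F"
  shows "G = E \<or> G = F"
proof (rule ccontr)
  assume "\<not> (G = E \<or> G = F)"
  then have ne: "E \<noteq> G" "F \<noteq> G"
    by auto
  define e f g' where "e = direction (a, 1) E" and "f = direction (a, 1) F" and "g' = direction (a, 1) G"
  have g': "g' = s *\<^sub>R e + t *\<^sub>R f"
    using g by (simp add: e_def f_def g'_def)
  have radF: "radius F = 1 \<or> radius F = r" and radG: "radius G = 1 \<or> radius G = r"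
    using F G by (auto simp: discs_def)
  have sq: "(1 + r)\<^sup>2 = 2"
    using r_square by (simp add: power2_eq_square algebra_simps)
  have ee: "e \<bullet> e = 4" and ff: "f \<bullet> f = (1 + radius F)\<^sup>2" and gg: "g' \<bullet> g' = (1 + radius G)\<^sup>2"
    using tangent_inner(1)[OF E(2)] tangent_inner(1)[OF F(2)] tangent_inner(1)[OF G(2)] E(3)
    by (simp_all add: e_def f_def g'_def)
  have "(f - e) \<bullet> (f - e) = (1 + radius F)\<^sup>2"
    using tangent_inner(1)[OF F(3)] E(3) by (simp add: e_def f_def)
  then have ef: "e \<bullet> f = 2"
    using ee ff by (simp add: inner_diff inner_commute)
  have ge: "g' \<bullet> e \<le> 2" and gf: "g' \<bullet> f \<le> 1 + radius F + radius G - radius F * radius G"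
    using neighbours_inner_le[OF E(1) G(1) ne(1) E(2) G(2)] neighbours_inner_le[OF F(1) G(1) ne(2) F(2) G(2)] E(3)
    by (simp_all add: e_def f_def g'_def)
  have "g' \<bullet> e = 4 * s + 2 * t" "g' \<bullet> f = 2 * s + (1 + radius F)\<^sup>2 * t"
    unfolding g' using ee ef ff by (simp_all add: inner_add_left inner_commute[of f e])
  note eqs = this
  \<comment> \<open>The bound equals 2 as soon as one of the two radii is 1, and
    \<open>4 * r < 2\<close> if both are \<open>r\<close>. This sharper value is needed at the end,
    when \<open>F\<close> and \<open>G\<close> are both small.\<close>
  have gf2: "g' \<bullet> f \<le> 2"
  proof -
    have "r * r = 1 - 2 * r"
      using r_square by (simp add: power2_eq_square)
    then show ?thesis
      using gf radF radG r_less by auto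
  qed
  have le: "g' \<bullet> g' \<le> 2 * (s + t)"
    using cone_inner_le[OF g' st ge gf2] .
  show False
  proof (cases "radius F = 1")
    case True
    then have "6 * (s + t) \<le> 4"
      using eqs ge gf2 by simp
    then have "g' \<bullet> g' < 2"
      using le by simp
    then show False
      using gg radG sq by auto
  next
    case False
    then have "radius F = r"
      using radF by blast
    then have "s + t \<le> 1"
      using eqs(2) gf2 sq by simp
    then have "g' \<bullet> g' \<le> 2"
      using le by simp
    then have "radius G = r"
      using gg radG by auto
    then have "2 * s + 2 * t \<le> 1 + r + r - r * r"
      using gf eqs(2) sq \<open>radius F = r\<close> by simp
    also have "\<dots> = 4 * r"
      using r_square by (simp add: power2_eq_square)
    finally have "g' \<bullet> g' < 2"
      using le r_less by simp
    then show False
      using gg sq \<open>radius G = r\<close> by simp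
  qed
qed

text \<open>A step from the midpoint of the edge in direction \<open>\<i> * u\<close> enters a tile
  on its left. This tile meets the edge in the hull of its corners among \<open>a\<close> and
  \<open>e\<close>; as the midpoint belongs to it, both are corners.\<close>

lemma edge_tile:
  assumes a: "a \<in> A" and e: "e \<in> A" "dist a e = 2"
  obtains v where "v \<bullet> v = 4" "(e - a) \<bullet> v = 2" "a + v \<in> A" "0 < cross (e - a) v"
  | v where "v \<bullet> v = 4" "(e - a) \<bullet> v = 0" "{a, a + (e - a), a + (e - a) + v, a + v} \<subseteq> A"
    "0 < cross (e - a) v"
proof -
  interpret tiling "tiles A"
    by unfold_locales (rule square_triangle_tiling_tiles[OF sep cover])
  define u where "u = e - a"
  have uu: "u \<bullet> u = 4"
    using e(2) by (simp add: u_def dist_norm norm_minus_commute flip: norm_eq_2_iff)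
  then have "u \<noteq> 0"
    by auto
  define m where "m = a + (1 / 2) *\<^sub>R u"
  obtain S \<epsilon> where S: "S \<in> tiles A" "m \<in> S" "0 < \<epsilon>" "m + \<epsilon> *\<^sub>R (\<i> * u) \<in> S"
    by (rule tile_in_direction)
  obtain V where V: "V \<subseteq> A" "tile_corners V" "S = convex hull V"
    using S(1) unfolding tiles_iff by blast
  have "m \<in> convex hull {a, e}"
    by (auto simp: m_def u_def closed_segment_def algebra_simps simp flip: segment_convex_hull
        intro!: exI[of _ "1 / 2"] simp: scaleR_left_distrib[symmetric])
  then have m: "m \<in> convex hull (V \<inter> {a, e})"
    using S(2) V(3) cell_Int(1)[OF cell_tile[OF sep V(1,2)] cell_edge[OF sep a e]] by blast
  have "m \<noteq> a" "m \<noteq> e"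
    using \<open>u \<noteq> 0\<close> by (auto simp: m_def u_def complex_eq_iff field_simps)
  have "a \<in> V" "e \<in> V"
  proof -
    show "a \<in> V"
    proof (rule ccontr)
      assume "a \<notin> V"
      then have "convex hull (V \<inter> {a, e}) \<subseteq> {e}"
        by (intro hull_minimal) auto
      then show False
        using m \<open>m \<noteq> e\<close> by blast
    qed
    show "e \<in> V"
    proof (rule ccontr)
      assume "e \<notin> V"
      then have "convex hull (V \<inter> {a, e}) \<subseteq> {a}"
        by (intro hull_minimal) auto
      then show False
        using m \<open>m \<noteq> a\<close> by blast
    qed
  qed
  define p where "p = m + \<epsilon> *\<^sub>R (\<i> * u)"
  have "0 < cross u (p - a)"
    using S(3) uu by (simp add: p_def m_def cross_simps cross_ii)
  \<comment> \<open>The tile has a point \<open>p\<close> strictly to the left of the edge, so its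
    second side vector at \<open>a\<close> points to the left.\<close>
  then have left: "0 < cross u v" if "p = a + s *\<^sub>R u + t *\<^sub>R v" "0 \<le> t" for s t v
    using that by (simp add: cross_simps zero_less_mult_iff)
  have p: "p \<in> convex hull V"
    using S(4) V(3) by (simp add: p_def)
  have eu: "e = a + u"
    by (simp add: u_def)
  show ?thesis
    using V(2)
  proof
    assume "square_corners V"
    then obtain w w' where w: "w \<bullet> w = 4" "w' \<bullet> w' = 4" "w \<bullet> w' = 0" "V = {a, a + w, a + w + w', a + w'}"
      using \<open>a \<in> V\<close> by (rule square_corner)
    \<comment> \<open>The edge is not a diagonal, whose squared length is 8.\<close>
    have "u \<noteq> w + w'"
      using w uu by (auto simp: inner_simps inner_commute)
    then have "u = w \<or> u = w'"
      using \<open>e \<in> V\<close> \<open>u \<noteq> 0\<close> unfolding w(4) eu by (auto simp: add.assoc)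
    then obtain v where v: "v \<bullet> v = 4" "u \<bullet> v = 0" "V = {a, a + u, a + u + v, a + v}"
      using w by (auto simp: inner_commute insert_commute add_ac)
    then obtain s t where "p = a + s *\<^sub>R u + t *\<^sub>R v" "0 \<le> t"
      using p unfolding v(3) convex_hull_square by blast
    then have "0 < cross u v"
      by (rule left)
    then show ?thesis
      using that(2) v V(1) unfolding u_def by blast
  next
    assume "triangle_corners V"
    then obtain w w' where w: "w \<bullet> w = 4" "w' \<bullet> w' = 4" "w \<bullet> w' = 2" "V = {a, a + w, a + w'}"
      using \<open>a \<in> V\<close> by (rule triangle_corner)
    then have "u = w \<or> u = w'"
      using \<open>e \<in> V\<close> \<open>u \<noteq> 0\<close> unfolding w(4) eu by auto
    then obtain v where v: "v \<bullet> v = 4" "u \<bullet> v = 2" "V = {a, a + u, a + v}"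
      using w by (auto simp: inner_commute insert_commute)
    then obtain s t where "p = a + s *\<^sub>R u + t *\<^sub>R v" "0 \<le> t"
      using p unfolding v(3) convex_hull_triangle by blast
    then have "0 < cross u v"
      by (rule left)
    then show ?thesis
      using that(1) v V(1) unfolding u_def by blast
  qed
qed

text \<open>The hypothesis of \<open>surrounds_intro\<close> for one neighbour, with the left turn
  expressed by \<open>cross\<close>.\<close>

definition followed_by :: "disc \<Rightarrow> disc \<Rightarrow> disc \<Rightarrow> bool" where
  "followed_by D E F \<longleftrightarrow> F \<in> discs \<and> tangent D F \<and> tangent E F \<and> 0 < cross (direction D E) (direction D F) \<and>
    (\<forall>G\<in>discs. tangent D G \<longrightarrow> (\<forall>s\<ge>0. \<forall>t\<ge>0.
      direction D G = s *\<^sub>R direction D E + t *\<^sub>R direction D F \<longrightarrow> G = E \<or> G = F))"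

text \<open>After a large neighbour comes the third corner of a triangle or the small disc in a
  square, according to the tile left of the edge. After a small neighbour comes the next corner of
  its square; there \<open>no_neighbour_between\<close> is applied with \<open>E\<close> and
  \<open>F\<close> exchanged, since its first disc has to be large.\<close>

lemma large_neighbour_followed:
  assumes a: "a \<in> A" and E: "E \<in> discs" "tangent (a, 1) E"
  shows "\<exists>F. followed_by (a, 1) E F"
  using E(1)
proof (cases rule: disc_cases)
  case (1 e)
  have ee: "(e - a) \<bullet> (e - a) = 4"
    using E(2) 1 by (simp add: tangent_large_large)
  then have "dist a e = 2"
    by (simp add: dist_norm norm_minus_commute flip: norm_eq_2_iff)
  with a 1(2) show ?thesis
  proof (cases rule: edge_tile)
    case v: (1 v)
    define F :: disc where "F = (a + v, 1)"
    have F: "F \<in> discs" "tangent (a, 1) F"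
      using v by (simp_all add: F_def discs_def tangent_large_large)
    have "(a + v - e) \<bullet> (a + v - e) = 4"
      using v ee by (simp add: inner_simps inner_commute)
    then have EF: "tangent E F"
      by (simp add: 1 F_def tangent_large_large)
    have "radius E = 1"
      by (simp add: 1)
    have "G = E \<or> G = F" if "G \<in> discs" "tangent (a, 1) G" "0 \<le> s" "0 \<le> t"
      "direction (a, 1) G = s *\<^sub>R direction (a, 1) E + t *\<^sub>R direction (a, 1) F" for G s t
      by (rule no_neighbour_between[OF E \<open>radius E = 1\<close> F EF that])
    moreover have "0 < cross (direction (a, 1) E) (direction (a, 1) F)"
      using v by (simp add: 1 F_def)
    ultimately show ?thesis
      unfolding followed_by_def using F EF by blast
  next
    case v: (2 v)
    define b where "b = a + ((e - a) + v) /\<^sub>R 2"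
    define F where "F = (b, r)"
    have b: "b \<in> square_centres A"
      using v ee unfolding square_centres_def b_def by blast
    have "(b - a) \<bullet> (b - a) = 2" "(b - e) \<bullet> (b - e) = 2"
      using v ee by (simp_all add: b_def inner_simps inner_commute)
    then have F: "F \<in> discs" "tangent (a, 1) F" and EF: "tangent E F"
      using b by (simp_all add: F_def 1 discs_def tangent_large_small)
    have "radius E = 1"
      by (simp add: 1)
    have "G = E \<or> G = F" if "G \<in> discs" "tangent (a, 1) G" "0 \<le> s" "0 \<le> t"
      "direction (a, 1) G = s *\<^sub>R direction (a, 1) E + t *\<^sub>R direction (a, 1) F" for G s t
      by (rule no_neighbour_between[OF E \<open>radius E = 1\<close> F EF that])
    moreover have "cross (e - a) (b - a) = cross (e - a) v / 2"
      by (simp add: b_def cross_simps)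
    then have "0 < cross (direction (a, 1) E) (direction (a, 1) F)"
      using v by (simp add: 1 F_def)
    ultimately show ?thesis
      unfolding followed_by_def using F EF by blast
  qed
next
  case (2 b)
  have "(a - b) \<bullet> (a - b) = 2"
    using E(2) 2 by (simp add: tangent_large_small inner_diff inner_commute)
  then obtain u v where uv: "u \<bullet> u = 4" "v \<bullet> v = 4" "u \<bullet> v = 0" "{a, a + u, a + u + v, a + v} \<subseteq> A"
    "b = a + (u + v) /\<^sub>R 2" "0 < cross u v"
    using square_centre_corner[OF sep 2(2) a] by metis
  define F :: disc where "F = (a + v, 1)"
  have "(a + v - b) \<bullet> (a + v - b) = 2"
    using uv(1-3) by (simp add: uv(5) inner_simps inner_commute)
  then have F: "F \<in> discs" "tangent (a, 1) F" and EF: "tangent E F"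
    using uv by (simp_all add: F_def 2 discs_def tangent_large_large tangent_small_large)
  have "radius F = 1" "tangent F E"
    using EF tangent_sym by (auto simp: F_def)
  have "G = E \<or> G = F" if G: "G \<in> discs" "tangent (a, 1) G" and st: "0 \<le> s" "0 \<le> t"
    and g: "direction (a, 1) G = s *\<^sub>R direction (a, 1) E + t *\<^sub>R direction (a, 1) F" for G s t
    using no_neighbour_between[OF F \<open>radius F = 1\<close> E \<open>tangent F E\<close> G st(2,1)] g by (auto simp: add.commute)
  moreover have "cross (b - a) v = cross u v / 2"
    by (simp add: uv(5) cross_simps)
  then have "0 < cross (direction (a, 1) E) (direction (a, 1) F)"
    using uv(6) by (simp add: 2 F_def)
  ultimately show ?thesis
    unfolding followed_by_def using F EF by blast
qed

lemma small_neighbour_large: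
  assumes "E \<in> discs" "tangent (b, r) E" "b \<in> square_centres A"
  obtains x where "E = (x, 1)" "x \<in> A" "(x - b) \<bullet> (x - b) = 2"
  using assms(1)
proof (cases rule: disc_cases)
  case (1 x)
  then show ?thesis
    using that assms(2) by (simp add: tangent_small_large)
next
  case (2 c)
  then have "dist b c = 2 * r"
    using assms(2) by (simp add: tangent_def)
  then show ?thesis
    using square_centres_spread[OF sep assms(3) 2(2)] r_pos r_less by (cases "b = c") auto
qed

text \<open>Seen from \<open>b\<close>, the corners lie in the directions \<open>e\<close>,
  \<open>f\<close>, \<open>- e\<close>, \<open>- f\<close>, in counterclockwise order. The last two
  have a negative inner product with \<open>e\<close> or \<open>f\<close> and so lie outside the
  cone of \<open>e\<close> and \<open>f\<close>.\<close>

lemma small_neighbour_followed: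
  assumes b: "b \<in> square_centres A" and E: "E \<in> discs" "tangent (b, r) E"
  shows "\<exists>F. followed_by (b, r) E F"
proof -
  obtain x where x: "E = (x, 1)" "x \<in> A" "(x - b) \<bullet> (x - b) = 2"
    using small_neighbour_large[OF E b] .
  obtain u v where uv: "u \<bullet> u = 4" "v \<bullet> v = 4" "u \<bullet> v = 0" and V: "{x, x + u, x + u + v, x + v} \<subseteq> A"
    and beq: "b = x + (u + v) /\<^sub>R 2" and left: "0 < cross u v"
    using square_centre_corner[OF sep b x(2,3)] .
  define F :: disc where "F = (x + u, 1)"
  have "(x + u - b) \<bullet> (x + u - b) = 2"
    using uv by (simp add: beq inner_simps inner_commute)
  then have F: "F \<in> discs" "tangent (b, r) F" and EF: "tangent E F"
    using V uv(1) by (simp_all add: F_def x discs_def tangent_small_large tangent_large_large)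
  define e f where "e = - ((u + v) /\<^sub>R 2)" and "f = (u - v) /\<^sub>R 2"
  have dir: "direction (b, r) E = e" "direction (b, r) F = f"
    by (simp_all add: x F_def beq e_def f_def complex_eq_iff field_simps)
  have ef: "e \<bullet> e = 2" "f \<bullet> f = 2" "e \<bullet> f = 0"
    using uv by (simp_all add: e_def f_def inner_simps inner_commute)
  have "G = E \<or> G = F" if G: "G \<in> discs" "tangent (b, r) G" and st: "0 \<le> s" "0 \<le> t"
    and g: "direction (b, r) G = s *\<^sub>R e + t *\<^sub>R f" for G s t
  proof -
    obtain y where y: "G = (y, 1)" "y \<in> A" "(y - b) \<bullet> (y - b) = 2"
      using small_neighbour_large[OF G b] .
    have "y - b = s *\<^sub>R e + t *\<^sub>R f"
      using g y by simp
    then have "0 \<le> (y - b) \<bullet> e" "0 \<le> (y - b) \<bullet> f"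
      using ef st by (simp_all add: inner_simps inner_commute)
    moreover have "y \<in> {x, x + u, x + u + v, x + v}"
      using square_circumcircle(2)[OF sep V uv beq y(2)] y(3) by blast
    moreover have "x + u + v - b = - e" "x + v - b = - f"
      by (simp_all add: beq e_def f_def complex_eq_iff field_simps)
    ultimately have "y = x \<or> y = x + u"
      using ef by auto
    then show ?thesis
      by (auto simp: y x F_def)
  qed
  moreover have "cross e f = cross u v / 2"
    by (simp add: e_def f_def cross_simps cross_commute[of v u])
  then have "0 < cross e f"
    using left by simp
  ultimately have "followed_by (b, r) E F"
    unfolding followed_by_def dir using F EF by blast
  then show ?thesis
    by blast
qed

lemma neighbours_nonempty:
  assumes "D \<in> discs"
  shows "{E \<in> discs. tangent D E} \<noteq> {}"
  using assms
proof (cases rule: disc_cases)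
  case (1 a)
  then obtain S where S: "S \<in> tiles A" "a \<in> vertices S"
    using vertices_tiles[OF sep cover] by blast
  then obtain V where V: "V \<subseteq> A" "tile_corners V" "a \<in> V"
    unfolding tiles_iff using vertices_tile by blast
  then obtain u where "u \<bullet> u = 4" "a + u \<in> V"
    by (metis insertI1 insertI2 square_corner triangle_corner)
  then have "(a + u, 1) \<in> discs" "tangent (a, 1) (a + u, 1)"
    using V(1) by (auto simp: discs_def tangent_large_large)
  then show ?thesis
    using 1 by blast
next
  case (2 b)
  then obtain a u v where uv: "u \<bullet> u = 4" "v \<bullet> v = 4" "u \<bullet> v = 0" "a \<in> A" "b = a + (u + v) /\<^sub>R 2"
    by (auto simp: square_centres_def)
  have "(a - b) \<bullet> (a - b) = 2"
    using uv(1-3) by (simp add: uv(5) inner_simps inner_commute)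
  then have "(a, 1) \<in> discs" "tangent (b, r) (a, 1)"
    using uv by (auto simp: discs_def tangent_small_large)
  then show ?thesis
    using 2 by blast
qed

lemma compact_packing_discs: "compact_packing_using {1, r} discs"
  unfolding compact_packing_using_def compact_packing_def
proof (intro conjI ballI packing_discs)
  fix D assume D: "D \<in> discs"
  have "\<exists>F. followed_by D E F" if "E \<in> discs" "tangent D E" for E
    using D
  proof (cases rule: disc_cases)
    case (1 a)
    then show ?thesis
      using large_neighbour_followed that by blast
  next
    case (2 b)
    then show ?thesis
      using small_neighbour_followed that by blast
  qed
  then show "\<exists>Ds. set Ds = {E \<in> discs. tangent D E} \<and> cyclically_ordered D Ds \<and> surrounds Ds D"
    using surrounds_intro[OF finite_neighbours neighbours_nonempty[OF D], of D]
    unfolding followed_by_def Im_divide_pos_cross by (smt (verit, best) mem_Collect_eq)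
next
  have "A \<noteq> {}"
    using squares by (auto simp: square_centres_def)
  then show "radius ` discs = {1, r}"
    using squares by (auto simp: discs_def image_Un)
qed

lemma packing_of_tiles_eq_discs: "packing_of_tiling r (tiles A) = discs"
  unfolding discs_def by (rule packing_of_tiles[OF sep cover])

lemma tiling_of_discs: "tiling_of_packing discs = tiles A"
  using r_less by (intro tiling_of_packing_eq_tiles[OF sep cover]) (auto simp: discs_def)

end

theorem mainTheorem6:
  fixes r :: real
  assumes "r = sqrt 2 - 1"
  defines "packings \<equiv> {P. compact_packing_using {1, r} P}"
    and "tilings \<equiv> {T. square_triangle_tiling T \<and> (\<exists>S\<in>T. is_square 2 S)}"
  shows "bij_betw tiling_of_packing packings tilings \<and>
         bij_betw (packing_of_tiling r) tilings packings \<and>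
         (\<forall>P\<in>packings. packing_of_tiling r (tiling_of_packing P) = P) \<and>
         (\<forall>T\<in>tilings. tiling_of_packing (packing_of_tiling r T) = T)"
proof -
  have packings: "tiling_of_packing P \<in> tilings \<and> packing_of_tiling r (tiling_of_packing P) = P"
    if "P \<in> packings" for P
  proof -
    interpret two_radius_packing r P
      by unfold_locales (use assms(1) that in \<open>auto simp: packings_def\<close>)
    have "tiling_of_packing P = tiles large"
      by (rule tiling_of_packing_eq_tiles[OF separated_large tiles_cover]) simp
    then show ?thesis
      using square_triangle_tiling_tiles[OF separated_large tiles_cover] square_tile packing_eq
      by (auto simp: tilings_def)
  qed
  have tilings: "packing_of_tiling r T \<in> packings \<and> tiling_of_packing (packing_of_tiling r T) = T"
    if "T \<in> tilings" for T
  proof -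
    have T: "square_triangle_tiling T" "\<exists>S\<in>T. is_square 2 S"
      using that by (simp_all add: tilings_def)
    obtain A where A: "separated A" "T = tiles A"
      using tiling_eq_tiles[OF T(1)] .
    moreover have "\<Union>(tiles A) = UNIV"
      using T(1) A(2) by (simp add: square_triangle_tiling_def)
    moreover have "square_centres A \<noteq> {}"
      using T(2) unfolding A(2) square_tile_centre[symmetric] by blast
    ultimately interpret good_tiles r A
      by unfold_locales (use assms(1) in auto)
    show ?thesis
      using compact_packing_discs packing_of_tiles_eq_discs tiling_of_discs A(2) by (simp add: packings_def)
  qed
  have "bij_betw tiling_of_packing packings tilings"
    by (rule bij_betwI[where g = "packing_of_tiling r"]) (use packings tilings in auto)
  moreover have "bij_betw (packing_of_tiling r) tilings packings"
    by (rule bij_betwI[where g = tiling_of_packing]) (use packings tilings in auto)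
  ultimately show ?thesis
    using packings tilings by blast
qed

end
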